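(* Let $\mathcal{A}\in\mathbb{R}^{n_1\times\cdots\times n_d}$ be a real tensor, with vectorization $\mathrm{vec}(\mathcal{A})$ regarded as a vector in an $(n_1\cdots n_d)$-dimensional vector space. There is an $(n_1\cdots n_d-1)$-dimensional vector space $\mathrm{opspan}(\mathcal{A})^\perp$ of tensors that are orthogonal to $\mathcal{A}$, where each basis vector of $\mathrm{opspan}(\mathcal{A})^\perp$ is required to be the vectorization of an outer product of vectors. The TTr1 decomposition of $\mathcal{A}$ allows one to find an orthogonal basis for $\mathrm{opspan}(\mathcal{A})^\perp$. Every tensor $\mathcal{B}\in\mathrm{opspan}(\mathcal{A})^\perp$ satisfies $\langle\mathcal{A},\mathcal{B}\rangle=0$, so $\mathrm{opspan}(\mathcal{A})^\perp$ can be interpreted as the orthogonal complement of $\mathrm{vec}(\mathcal{A})$. The basis is illustrated on the tensor $\mathcal{A}\in\mathbb{R}^{3\times4\times2}$ with entries $\mathcal{A}_{i_1i_2i_3}=i_1+3(i_2-1)+12(i_3-1)$, as follows. Let $\bar{\mathcal{A}}=\sum_{i=1}^{3}\sigma_i u_iv_i^T$ be the economical SVD of its $3\times8$ reshaping, and let $\bar v_i$ be the $4\times2$ reshaping of $v_i$, with full SVD having left singular vectors $u_{i1},u_{i2},u_{i3},u_{i4}$, right singular vectors $v_{i1},v_{i2}$ and singular values $\sigma_{i1},\sigma_{i2}$. The full TTr1 decomposition consists of the $8\times3=24$ orthogonal rank-1 terms $u_i\circ u_{ij}\circ v_{ik}$ ($1\le i\le3$, $1\le j\le4$, $1\le k\le2$).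 Let $\mathcal{T}_1,\dots,\mathcal{T}_6$ be the six terms with $j=k$, with weights $\tilde\sigma_1,\dots,\tilde\sigma_6$ given by the corresponding products $\sigma_i\sigma_{ij}$ (the terms of the economical TTr1 decomposition), and let $\mathcal{T}_7,\dots,\mathcal{T}_{24}$ be the remaining $18$ terms, which have weight $0$. Then $$\mathrm{vec}(\mathcal{A})=\begin{pmatrix}\mathrm{vec}(\mathcal{T}_1)&\cdots&\mathrm{vec}(\mathcal{T}_{24})\end{pmatrix}\begin{pmatrix}\tilde\sigma_1&\cdots&\tilde\sigma_6&0&\cdots&0\end{pmatrix}^T.$$ The vectors $\mathrm{vec}(\mathcal{T}_7),\dots,\mathrm{vec}(\mathcal{T}_{24})$ are orthogonal to $\mathrm{vec}(\mathcal{A})$ and are $18$ of the basis vectors of $\mathrm{opspan}(\mathcal{A})^\perp$. The remaining $5$ basis vectors are the linear combinations $$\begin{pmatrix}\mathrm{vec}(\mathcal{T}_1)&\cdots&\mathrm{vec}(\mathcal{T}_6)\end{pmatrix}S^\perp,$$ where $S^\perp$ is the $6\times5$ matrix orthogonal to $\begin{pmatrix}\tilde\sigma_1&\cdots&\tilde\sigma_6\end{pmatrix}$.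
   Context: The inner product of tensors is $\langle\mathcal{A},\mathcal{B}\rangle=\sum_{i_1,\dots,i_d}\mathcal{A}_{i_1\cdots i_d}\mathcal{B}_{i_1\cdots i_d}$, and $\mathrm{vec}(\mathcal{A})\in\mathbb{R}^{n_1\cdots n_d}$ is the vector obtained by taking all indices of $\mathcal{A}$ together in one mode. The outer product $a\circ b\circ c$ is the rank-1 tensor with entries $a_{i_1}b_{i_2}c_{i_3}$, and similarly for $d$ vectors. The TTr1 (tensor-train rank-1) decomposition of a $d$-way tensor $\mathcal{A}$ is obtained as follows. Reshape $\mathcal{A}$ into an $n_1\times(n_2\cdots n_d)$ matrix and compute its SVD. Then reshape each resulting right singular vector into an $n_2\times(n_3\cdots n_d)$ matrix and compute its SVD, and continue recursively, through $d-1$ levels of singular values in a tree. Each branch of the tree gives one rank-1 outer product: its mode vectors are the left singular vectors along the branch together with the last right singular vector, and its weight is the product of the singular values along the branch. $\mathcal{A}$ is the sum of these weighted, mutually orthogonal, unit-norm outer products. The economical decomposition uses economical SVDs. Using full SVDs of the reshaped right singular vectors and pairing every left singular vector with every right singular vector gives additional orthogonal outer products, with weight zero, corresponding to the zero entries of the singular value matrices. For the $3\times4\times2$ tensor, the $3\times8$ reshaping $\bar{\mathcal{A}}$ has rows indexed by $i_1$ and columns indexed by $(i_2,i_3)$, and each $v_i\in\mathbb{R}^8$, indexed by $(i_2,i_3)$, is reshaped into the $4\times2$ matrix $\bar v_i$ with rows indexed by $i_2$ and columns by $i_3$. Zero singular values are kept in the SVDs.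
   Formalization: The tensor is assumed nonzero (for zero, the complement has full dimension), and the basis of outer products and the orthogonal TTr1 basis are asserted separately, since a basis with both properties need not exist (e.g. for the 2×2 identity). *)

theory Defs
  imports "Jordan_Normal_Form.DL_Rank"
begin

(* Tensors of shape ns = [n1,...,nd]: a tensor is given by its entries, only those at multi-indices
   in the index set of ns are relevant. Indices start at 0. *)
type_synonym tensor = "nat list \<Rightarrow> real"

definition tensor_indices :: "nat list \<Rightarrow> nat list set" where
  "tensor_indices ns = {is. list_all2 (<) is ns}"

definition tensor_inner :: "nat list \<Rightarrow> tensor \<Rightarrow> tensor \<Rightarrow> real" where
  "tensor_inner ns A B = (\<Sum>is\<in>tensor_indices ns. A is * B is)"

(* Column-major (first index fastest) enumeration of the multi-indices: the inverse of
   [i1,...,id] |-> i1 + n1 * (i2 + n2 * (i3 + ...)). *)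
fun multi_index :: "nat list \<Rightarrow> nat \<Rightarrow> nat list" where
  "multi_index [] p = []"
| "multi_index (n # ns) p = (p mod n) # multi_index ns (p div n)"

definition vectorize :: "nat list \<Rightarrow> tensor \<Rightarrow> real vec" where
  "vectorize ns A = vec (prod_list ns) (\<lambda>p. A (multi_index ns p))"

(* If a is the vectorization of a tensor of shape m # ns and k = prod_list ns, then row i of
   reshape m k a is the first index, and the column is the vectorization of the other indices. *)
definition reshape :: "nat \<Rightarrow> nat \<Rightarrow> real vec \<Rightarrow> real mat" where
  "reshape m k a = mat m k (\<lambda>(i, j). a $ (i + m * j))"

definition outer :: "real vec list \<Rightarrow> tensor" where
  "outer xs = (\<lambda>is. \<Prod>k<length xs. (xs ! k) $ (is ! k))"

definition mode_vectors :: "nat list \<Rightarrow> real vec list \<Rightarrow> bool" where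
  "mode_vectors ns xs \<longleftrightarrow> list_all2 (\<lambda>x n. x \<in> carrier_vec n) xs ns"

(* The space with a basis of vectorized outer products orthogonal to A is rendered as the span of
   all such outer products; its dimension is part of the theorem. *)
definition opspan_perp :: "nat list \<Rightarrow> tensor \<Rightarrow> real vec set" where
  "opspan_perp ns A = LinearCombinations.module.span class_ring
     (module_vec TYPE(real) (prod_list ns))
     {vectorize ns (outer xs) | xs. mode_vectors ns xs \<and> tensor_inner ns A (outer xs) = 0}"

definition basis_of :: "nat \<Rightarrow> real vec set \<Rightarrow> real vec list \<Rightarrow> bool" where
  "basis_of N W bs \<longleftrightarrow> distinct bs \<and>
     vectorspace.basis class_ring ((module_vec TYPE(real) N)\<lparr>carrier := W\<rparr>) (set bs)"

(* Singular value decomposition M = U S V^T with at least min(m,k) left and right singular vectors,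
   so that zero singular values are kept; the extreme cases are the full and the economical SVD. *)
definition is_svd :: "real mat \<Rightarrow> real mat \<Rightarrow> real mat \<Rightarrow> real mat \<Rightarrow> bool" where
  "is_svd M U S V \<longleftrightarrow>
     (let m = dim_row M; k = dim_col M; p = dim_col U; q = dim_col V in
      U \<in> carrier_mat m p \<and> V \<in> carrier_mat k q \<and> S \<in> carrier_mat p q \<and>
      min m k \<le> p \<and> min m k \<le> q \<and>
      transpose_mat U * U = 1\<^sub>m p \<and> transpose_mat V * V = 1\<^sub>m q \<and>
      diagonal_mat S \<and>
      (\<forall>i < min p q. 0 \<le> S $$ (i, i)) \<and>
      (\<forall>i j. i \<le> j \<longrightarrow> j < min p q \<longrightarrow> S $$ (j, j) \<le> S $$ (i, i)) \<and>
      M = U * S * transpose_mat V)"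

definition full_svd :: "real mat \<Rightarrow> real mat \<Rightarrow> real mat \<Rightarrow> real mat \<Rightarrow> bool" where
  "full_svd M U S V \<longleftrightarrow> is_svd M U S V \<and> dim_col U = dim_row M \<and> dim_col V = dim_col M"

definition economical_svd :: "real mat \<Rightarrow> real mat \<Rightarrow> real mat \<Rightarrow> real mat \<Rightarrow> bool" where
  "economical_svd M U S V \<longleftrightarrow> is_svd M U S V \<and>
     dim_col U = min (dim_row M) (dim_col M) \<and> dim_col V = min (dim_row M) (dim_col M)"

(* full_TTr1 ns a ts zs: full TTr1 decomposition of the tensor of shape ns with vectorization a
   (at least two modes). ts lists the weights and mode vectors of the terms of the economical
   decomposition, zs the mode vectors of the additional, zero-weight terms.
   At the last level every left singular vector is paired with every right one. At the other
   levels each left singular vector i is joined to the full decomposition of its own right singular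
   vector; a left singular vector that has none (only possible if m > prod_list ns) is joined to the
   decomposition of some right singular vector c i, the weight being the zero entry S $$ (i, c i). *)
inductive full_TTr1 ::
  "nat list \<Rightarrow> real vec \<Rightarrow> (real \<times> real vec list) list \<Rightarrow> real vec list list \<Rightarrow> bool" where
  last_level:
    "full_svd (reshape m n a) U S V \<Longrightarrow>
     full_TTr1 [m, n] a
       [(S $$ (j, j), [col U j, col V j]). j \<leftarrow> [0..<min m n]]
       [[col U j, col V k]. j \<leftarrow> [0..<m], k \<leftarrow> [0..<n], j \<noteq> k]"
| level:
    "2 \<le> length ns \<Longrightarrow>
     is_svd (reshape m (prod_list ns) a) U S V \<Longrightarrow> dim_col U = m \<Longrightarrow>
     \<forall>i<m. c i < dim_col V \<and> (i < prod_list ns \<longrightarrow> c i = i) \<Longrightarrow>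
     \<forall>i<m. full_TTr1 ns (col V (c i)) (ts i) (zs i) \<Longrightarrow>
     full_TTr1 (m # ns) a
       [(S $$ (i, i) * w, col U i # xs). i \<leftarrow> [0..<min m (prod_list ns)], (w, xs) \<leftarrow> ts i]
       ([col U i # xs. i \<leftarrow> [0..<m], xs \<leftarrow> zs i] @
        [col U i # xs. i \<leftarrow> [prod_list ns..<m], (w, xs) \<leftarrow> ts i])"

(* P has r - 1 linearly independent columns, all orthogonal to s in R^r. *)
definition perp_matrix :: "real vec \<Rightarrow> real mat \<Rightarrow> bool" where
  "perp_matrix s P \<longleftrightarrow> P \<in> carrier_mat (dim_vec s) (dim_vec s - 1) \<and>
     transpose_mat P *\<^sub>v s = 0\<^sub>v (dim_vec s - 1) \<and>
     vec_space.rank (dim_vec s) P = dim_vec s - 1"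

(* i1 + 3 (i2 - 1) + 12 (i3 - 1) for indices starting at 1 *)
definition example_tensor :: tensor where
  "example_tensor is = real ((is ! 0 + 1) + 3 * (is ! 1) + 12 * (is ! 2))"

end

theory Submission
  imports "Jordan_Normal_Form.Char_Poly" Defs
begin

text \<open>The space opspan_perp is, by definition, spanned by those outer products that are orthogonal to A. The
  theorem says that it is the whole hyperplane orthogonal to vec(A), and that a decomposition yields explicit bases of this
  hyperplane. These two claims have separate proofs.

  That outer products span the hyperplane is a duality argument: a vector annihilated by all outer products that
  annihilate a is a multiple of a (\<open>rank_one_annihilator\<close>). This is shown by induction on the number of modes, by
  contracting the first mode. Choosing independent vectors greedily among the outer products then ends with a basis
  of the hyperplane (\<open>rank_one_hyperplane_basis\<close>).

  The decomposition enters through two facts. Its terms, those of weight zero included, form an orthonormal basis of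
  the whole space (\<open>full_TTr1_orthonormal_terms\<close>), because at each level an orthonormal basis of the first mode is joined
  to orthonormal bases of the remaining modes and scalar products of outer products multiply. And A is the sum of the weighted
  terms (\<open>full_TTr1_expansion\<close>), by inserting one singular value decomposition into the other. Hence the terms Z of weight zero
  are orthogonal to A, and a combination T x of the weighted terms T is orthogonal to A exactly if x is orthogonal to the
  vector s of weights. Together with T P, where P has as columns a basis of the orthogonal complement of s, the family Z thus
  consists of N - 1 independent vectors of the hyperplane (\<open>basis_of_hyperplane\<close>).

  The existence of decompositions reduces to that of singular value decompositions (\<open>full_svd_exists\<close>), which are
  obtained from an orthonormal eigenbasis of M^T M, constructed by deflation (\<open>symmetric_eigenbasis\<close>). The 3 x 4 x 2
  example is an instance of the general statement, since its terms are a full decomposition in the sense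
  of the definition (\<open>example_full_TTr1\<close>).\<close>

section \<open>Orthonormal families and hyperplanes\<close>

text \<open>Padding with zero rows makes the matrix square and singular, so that the determinant criterion
  for a nontrivial kernel applies.\<close>

lemma wide_matrix_kernel:
  fixes M :: "'a :: field mat"
  assumes M: "M \<in> carrier_mat r n" and "r < n"
  obtains v where "v \<in> carrier_vec n" "v \<noteq> 0\<^sub>v n" "M *\<^sub>v v = 0\<^sub>v r"
proof -
  define A where "A = mat n n (\<lambda>(i, j). if i < r then M $$ (i, j) else 0)"
  have A: "A \<in> carrier_mat n n" by (simp add: A_def)
  have "transpose_mat A *\<^sub>v unit_vec n r = 0\<^sub>v n"
    by (rule eq_vecI) (use \<open>r < n\<close> in \<open>auto simp: A_def\<close>)
  moreover have "unit_vec n r \<noteq> (0\<^sub>v n :: 'a vec)" using \<open>r < n\<close> by simp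
  ultimately have "det (transpose_mat A) = 0"
    using A by (subst det_0_iff_vec_prod_zero_field[of _ n]) (auto intro!: exI[of _ "unit_vec n r"])
  then have "det A = 0" using det_transpose[OF A] by simp
  then obtain v where v: "v \<in> carrier_vec n" "v \<noteq> 0\<^sub>v n" "A *\<^sub>v v = 0\<^sub>v n"
    using det_0_iff_vec_prod_zero_field[OF A] by auto
  have "M *\<^sub>v v = 0\<^sub>v r"
  proof (rule eq_vecI)
    fix i assume "i < dim_vec (0\<^sub>v r :: 'a vec)"
    then have i: "i < r" by simp
    then have "row M i = row A i" using M \<open>r < n\<close> by (auto simp: A_def)
    moreover have "(A *\<^sub>v v) $ i = 0" using v(3) i \<open>r < n\<close> by simp
    ultimately show "(M *\<^sub>v v) $ i = 0\<^sub>v r $ i" using i \<open>r < n\<close> M A by simp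
  qed (use M in simp)
  with v that show thesis by blast
qed

lemma injective_square_matrix_surj:
  fixes M :: "'a :: field mat"
  assumes M: "M \<in> carrier_mat n n" and v: "v \<in> carrier_vec n"
    and inj: "\<And>c. c \<in> carrier_vec n \<Longrightarrow> M *\<^sub>v c = 0\<^sub>v n \<Longrightarrow> c = 0\<^sub>v n"
  obtains c where "c \<in> carrier_vec n" "M *\<^sub>v c = v"
proof -
  have "det M \<noteq> 0" using det_0_iff_vec_prod_zero_field[OF M] inj by auto
  then obtain B where B: "B \<in> carrier_mat n n" "M * B = 1\<^sub>m n"
    using det_non_zero_imp_unit[OF M] unfolding Units_def ring_mat_simps by auto
  have "M *\<^sub>v (B *\<^sub>v v) = v" using B v M by (metis assoc_mult_mat_vec one_mult_mat_vec)
  with that B v show thesis by (meson mult_mat_vec_carrier)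
qed

definition orthonormal :: "nat \<Rightarrow> real vec list \<Rightarrow> bool" where
  "orthonormal n vs \<longleftrightarrow> set vs \<subseteq> carrier_vec n \<and>
     (\<forall>i<length vs. \<forall>j<length vs. vs ! i \<bullet> vs ! j = (if i = j then 1 else 0))"

lemma orthonormal_iff_set:
  "orthonormal n vs \<longleftrightarrow> set vs \<subseteq> carrier_vec n \<and> distinct vs \<and>
     (\<forall>u\<in>set vs. \<forall>v\<in>set vs. u \<bullet> v = (if u = v then 1 else 0))"
proof
  assume o: "orthonormal n vs"
  have "distinct vs"
    unfolding distinct_conv_nth using o unfolding orthonormal_def by (metis zero_neq_one)
  with o show "set vs \<subseteq> carrier_vec n \<and> distinct vs \<and>
     (\<forall>u\<in>set vs. \<forall>v\<in>set vs. u \<bullet> v = (if u = v then 1 else 0))"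
    unfolding orthonormal_def by (auto simp: in_set_conv_nth nth_eq_iff_index_eq)
next
  assume "set vs \<subseteq> carrier_vec n \<and> distinct vs \<and>
     (\<forall>u\<in>set vs. \<forall>v\<in>set vs. u \<bullet> v = (if u = v then 1 else 0))"
  then show "orthonormal n vs"
    unfolding orthonormal_def by (auto simp: nth_eq_iff_index_eq)
qed

lemma orthonormal_gram:
  assumes "orthonormal n vs"
  shows "transpose_mat (mat_of_cols n vs) * mat_of_cols n vs = 1\<^sub>m (length vs)"
  by (rule eq_matI) (use assms in \<open>auto simp: orthonormal_def subset_iff\<close>)

lemma gram_one_cols:
  assumes "U \<in> carrier_mat m p" "transpose_mat U * U = 1\<^sub>m p" "i < p" "j < p"
  shows "col U i \<bullet> col U j = (if i = j then 1 else (0::real))"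
proof -
  have "col U i \<bullet> col U j = (transpose_mat U * U) $$ (i, j)" using assms(1,3,4) by simp
  then show ?thesis unfolding assms(2) using assms(3,4) by simp
qed

lemma gram_one_cancel:
  fixes A :: "'a :: field mat"
  assumes A: "A \<in> carrier_mat n r" "transpose_mat A * A = 1\<^sub>m r" and c: "c \<in> carrier_vec r"
  shows "transpose_mat A *\<^sub>v (A *\<^sub>v c) = c"
proof -
  have "transpose_mat A *\<^sub>v (A *\<^sub>v c) = (transpose_mat A * A) *\<^sub>v c"
    by (rule assoc_mult_mat_vec[symmetric, of _ r n _ r]) (use A(1) c in auto)
  then show ?thesis using A(2) c by simp
qed

lemma gram_one_kernel:
  fixes A :: "'a :: field mat"
  assumes A: "A \<in> carrier_mat n r" "transpose_mat A * A = 1\<^sub>m r"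
    and c: "c \<in> carrier_vec r" "A *\<^sub>v c = 0\<^sub>v n"
  shows "c = 0\<^sub>v r"
proof -
  have "c = transpose_mat A *\<^sub>v 0\<^sub>v n" using gram_one_cancel[OF A c(1)] c(2) by simp
  also have "\<dots> = 0\<^sub>v r" using A by auto
  finally show ?thesis .
qed

lemma orthonormal_length:
  assumes "orthonormal n vs"
  shows "length vs \<le> n"
proof (rule ccontr)
  assume "\<not> length vs \<le> n"
  moreover have A: "mat_of_cols n vs \<in> carrier_mat n (length vs)" by simp
  ultimately obtain c where "c \<in> carrier_vec (length vs)" "c \<noteq> 0\<^sub>v (length vs)"
      "mat_of_cols n vs *\<^sub>v c = 0\<^sub>v n"
    using wide_matrix_kernel[OF A] by auto
  with gram_one_kernel[OF A orthonormal_gram[OF assms]] show False by blast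
qed

lemma orthonormal_snoc:
  fixes v :: "real vec"
  assumes us: "orthonormal n us" and v: "v \<in> carrier_vec n" "v \<noteq> 0\<^sub>v n"
    and ort: "\<And>u. u \<in> set us \<Longrightarrow> u \<bullet> v = 0"
  shows "orthonormal n (us @ [(1 / sqrt (v \<bullet> v)) \<cdot>\<^sub>v v])"
  unfolding orthonormal_def
proof (intro conjI allI impI)
  let ?w = "(1 / sqrt (v \<bullet> v)) \<cdot>\<^sub>v v"
  have "v \<bullet> v > 0" using conjugate_square_greater_0_vec[OF v(1)] v(2) by simp
  then have w1: "?w \<bullet> ?w = 1" using v(1) by simp
  have carr: "us ! i \<in> carrier_vec n" if "i < length us" for i
    using us that by (simp add: orthonormal_def subset_iff)
  have "us ! i \<bullet> v = 0" "v \<bullet> us ! i = 0" if "i < length us" for i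
    using ort[of "us ! i"] comm_scalar_prod[OF v(1) carr[OF that]] that by simp_all
  moreover fix i j assume "i < length (us @ [?w])" "j < length (us @ [?w])"
  ultimately show "(us @ [?w]) ! i \<bullet> (us @ [?w]) ! j = (if i = j then 1 else 0)"
    using us w1 v(1) carr[of i] carr[of j]
    by (auto simp: orthonormal_def nth_append less_Suc_eq)
qed (use us v in \<open>auto simp: orthonormal_def\<close>)

text \<open>As long as there are fewer than n vectors, the homogeneous system asking for orthogonality to all
  of them is underdetermined; a normalized solution is the next vector.\<close>

lemma orthonormal_extend:
  assumes "orthonormal n us"
  obtains vs where "orthonormal n (us @ vs)" "length (us @ vs) = n"
proof -
  have "\<exists>vs. orthonormal n (us @ vs) \<and> length (us @ vs) = n"
    using assms
  proof (induction "n - length us" arbitrary: us)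
    case 0
    then show ?case using orthonormal_length[of n us] by (intro exI[of _ "[]"]) simp
  next
    case (Suc d)
    let ?M = "mat_of_rows n us"
    have "length us < n" using Suc(2) by simp
    then obtain v where v: "v \<in> carrier_vec n" "v \<noteq> 0\<^sub>v n" "?M *\<^sub>v v = 0\<^sub>v (length us)"
      using wide_matrix_kernel[of ?M "length us" n] mat_of_rows_carrier(1)[of n us] by metis
    have us: "set us \<subseteq> carrier_vec n" using Suc(3) by (simp add: orthonormal_def)
    have ort: "us ! i \<bullet> v = 0" if "i < length us" for i
    proof -
      have "us ! i \<bullet> v = (?M *\<^sub>v v) $ i" using that us by (simp add: subset_iff)
      then show ?thesis unfolding v(3) using that by simp
    qed
    define w where "w = (1 / sqrt (v \<bullet> v)) \<cdot>\<^sub>v v"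
    have "d = n - length (us @ [w])" using Suc(2) by simp
    moreover have "orthonormal n (us @ [w])"
      unfolding w_def using orthonormal_snoc[OF Suc(3) v(1,2)] ort by (metis in_set_conv_nth)
    ultimately obtain vs where
      "orthonormal n ((us @ [w]) @ vs)" "length ((us @ [w]) @ vs) = n"
      using Suc(1)[of "us @ [w]"] by metis
    then show ?case by (intro exI[of _ "w # vs"]) simp
  qed
  with that show thesis by blast
qed

lemma orthonormal_complete:
  assumes us: "orthonormal n us" "length us = n"
    and z: "z \<in> carrier_vec n" "\<And>u. u \<in> set us \<Longrightarrow> u \<bullet> z = 0"
  shows "z = 0\<^sub>v n"
proof -
  let ?U = "mat_of_cols n us"
  have U: "?U \<in> carrier_mat n n" using mat_of_cols_carrier(1)[of n us] us(2) by simp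
  have "?U * transpose_mat ?U = 1\<^sub>m n"
    using orthonormal_gram[OF us(1)] us(2) U
    by (intro mat_mult_left_right_inverse[of "transpose_mat ?U"]) auto
  then have "z = ?U *\<^sub>v (transpose_mat ?U *\<^sub>v z)"
    using z(1) U by (metis assoc_mult_mat_vec one_mult_mat_vec transpose_carrier_mat)
  also have "transpose_mat ?U *\<^sub>v z = 0\<^sub>v n"
    by (rule eq_vecI) (use us z in \<open>auto simp: orthonormal_def subset_iff\<close>)
  also have "?U *\<^sub>v 0\<^sub>v n = 0\<^sub>v n" using U by auto
  finally show ?thesis .
qed

lemma mat_of_cols_append_mult:
  fixes u v :: "'a :: comm_semiring_0 vec"
  assumes "u \<in> carrier_vec (length xs)" "v \<in> carrier_vec (length ys)"
  shows "mat_of_cols n (xs @ ys) *\<^sub>v (u @\<^sub>v v) = mat_of_cols n xs *\<^sub>v u + mat_of_cols n ys *\<^sub>v v"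
proof (rule eq_vecI)
  fix i assume "i < dim_vec (mat_of_cols n xs *\<^sub>v u + mat_of_cols n ys *\<^sub>v v)"
  then have i: "i < n" by simp
  have "row (mat_of_cols n (xs @ ys)) i = row (mat_of_cols n xs) i @\<^sub>v row (mat_of_cols n ys) i"
    by (rule eq_vecI) (use i in \<open>auto simp: mat_of_cols_index nth_append\<close>)
  then show "(mat_of_cols n (xs @ ys) *\<^sub>v (u @\<^sub>v v)) $ i
      = (mat_of_cols n xs *\<^sub>v u + mat_of_cols n ys *\<^sub>v v) $ i"
    using i assms by (simp add: scalar_prod_append[of _ "length xs" _ "length ys"])
qed simp

lemma mat_of_cols_snoc_mult:
  fixes a :: "'a :: comm_semiring_1 vec"
  assumes c: "c \<in> carrier_vec (Suc (length bs))" and a: "a \<in> carrier_vec N"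
  obtains x t where "x \<in> carrier_vec (length bs)" "c = x @\<^sub>v vec 1 (\<lambda>_. t)"
    "mat_of_cols N (bs @ [a]) *\<^sub>v c = mat_of_cols N bs *\<^sub>v x + t \<cdot>\<^sub>v a"
proof -
  define x where "x = vec (length bs) (\<lambda>i. c $ i)"
  define t where "t = c $ length bs"
  have cx: "c = x @\<^sub>v vec 1 (\<lambda>_. t)"
    by (rule eq_vecI) (use c in \<open>auto simp: x_def t_def less_Suc_eq\<close>)
  have x: "x \<in> carrier_vec (length bs)" by (simp add: x_def)
  have "mat_of_cols N [a] *\<^sub>v vec 1 (\<lambda>_. t) = t \<cdot>\<^sub>v a"
    by (rule eq_vecI) (use a in \<open>auto simp: scalar_prod_def mat_of_cols_index mult.commute\<close>)
  then have "mat_of_cols N (bs @ [a]) *\<^sub>v c = mat_of_cols N bs *\<^sub>v x + t \<cdot>\<^sub>v a"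
    unfolding cx using x by (subst mat_of_cols_append_mult) auto
  with that cx x show thesis by blast
qed

text \<open>Independence of a family rather than of a set: the map from coefficients to linear combinations is
  injective, so a list with a repeated vector is dependent.\<close>

definition indep_list :: "nat \<Rightarrow> real vec list \<Rightarrow> bool" where
  "indep_list N bs \<longleftrightarrow> set bs \<subseteq> carrier_vec N \<and>
     (\<forall>c\<in>carrier_vec (length bs). mat_of_cols N bs *\<^sub>v c = 0\<^sub>v N \<longrightarrow> c = 0\<^sub>v (length bs))"

text \<open>The vector b is a witness that s lies outside the span of bs: it annihilates bs but not s.\<close>

lemma indep_list_snoc:
  assumes bs: "indep_list N bs" and s: "s \<in> carrier_vec N"
    and b: "b \<in> carrier_vec N" "\<And>u. u \<in> set bs \<Longrightarrow> u \<bullet> b = 0" "s \<bullet> b \<noteq> 0"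
  shows "indep_list N (bs @ [s])"
  unfolding indep_list_def
proof (intro conjI ballI impI)
  fix c :: "real vec"
  assume c: "c \<in> carrier_vec (length (bs @ [s]))" "mat_of_cols N (bs @ [s]) *\<^sub>v c = 0\<^sub>v N"
  have B: "mat_of_cols N bs \<in> carrier_mat N (length bs)" by simp
  obtain x t where xt: "x \<in> carrier_vec (length bs)" "c = x @\<^sub>v vec 1 (\<lambda>_. t)"
    "mat_of_cols N (bs @ [s]) *\<^sub>v c = mat_of_cols N bs *\<^sub>v x + t \<cdot>\<^sub>v s"
    using mat_of_cols_snoc_mult[of c bs s N] c(1) s by auto
  have "transpose_mat (mat_of_cols N bs) *\<^sub>v b = 0\<^sub>v (length bs)"
    by (rule eq_vecI) (use bs b in \<open>auto simp: indep_list_def subset_iff\<close>)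
  then have "b \<bullet> (mat_of_cols N bs *\<^sub>v x) = 0"
    using transpose_vec_mult_scalar[OF B xt(1) b(1)] xt(1) by simp
  then have "b \<bullet> (mat_of_cols N (bs @ [s]) *\<^sub>v c) = t * (b \<bullet> s)"
    unfolding xt(3) using b(1) s mult_mat_vec_carrier[OF B xt(1)]
    by (subst scalar_prod_add_distrib[of _ N]) auto
  then have t: "t = 0" using c(2) b(1,3) comm_scalar_prod[OF b(1) s] by simp
  have "mat_of_cols N bs *\<^sub>v x = 0\<^sub>v N" using xt(3) c(2) s xt(1) unfolding t by auto
  then have "x = 0\<^sub>v (length bs)" using bs xt(1) by (simp add: indep_list_def)
  then show "c = 0\<^sub>v (length (bs @ [s]))" unfolding xt(2) t by (intro eq_vecI) auto
qed (use bs s in \<open>auto simp: indep_list_def\<close>)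

lemma indep_list_distinct:
  assumes "indep_list N bs"
  shows "distinct bs"
  unfolding distinct_conv_nth
proof (intro allI impI notI)
  let ?B = "mat_of_cols N bs" and ?l = "length bs"
  fix i j assume ij: "i < ?l" "j < ?l" "i \<noteq> j" "bs ! i = bs ! j"
  define c :: "real vec" where "c = unit_vec ?l i - unit_vec ?l j"
  have c: "c \<in> carrier_vec ?l" by (simp add: c_def)
  have "?B *\<^sub>v c = ?B *\<^sub>v unit_vec ?l i - ?B *\<^sub>v unit_vec ?l j"
    unfolding c_def by (rule mult_minus_distrib_mat_vec[of _ N ?l]) auto
  also have "\<dots> = col ?B i - col ?B j"
    using ij by (intro arg_cong2[of _ _ _ _ "(-)"] eq_vecI) auto
  also have "\<dots> = 0\<^sub>v N" using ij assms by (simp add: indep_list_def subset_iff)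
  finally have "c = 0\<^sub>v ?l" using assms c by (simp add: indep_list_def)
  moreover have "c $ i = 1" using ij by (simp add: c_def)
  ultimately show False using ij by simp
qed

lemma indep_list_spanning:
  assumes bs: "indep_list N bs" "length bs = N" and v: "v \<in> carrier_vec N"
  obtains c where "c \<in> carrier_vec N" "mat_of_cols N bs *\<^sub>v c = v"
proof (rule injective_square_matrix_surj[OF _ v])
  show "mat_of_cols N bs \<in> carrier_mat N N" using mat_of_cols_carrier(1)[of N bs] bs(2) by simp
  show "c = 0\<^sub>v N" if "c \<in> carrier_vec N" "mat_of_cols N bs *\<^sub>v c = 0\<^sub>v N" for c
    using bs that by (simp add: indep_list_def)
qed (use that in blast)

text \<open>Appending the normal vector a to bs gives a basis of the whole space. The scalar product with a
  isolates the coefficient of a in an expansion, and this coefficient vanishes for vectors of the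
  hyperplane.\<close>

lemma hyperplane_basis:
  fixes a :: "real vec"
  assumes a: "a \<in> carrier_vec N" "a \<noteq> 0\<^sub>v N"
    and bs: "indep_list N bs" "length bs = N - 1" "\<And>b. b \<in> set bs \<Longrightarrow> b \<bullet> a = 0"
  shows "\<not> LinearCombinations.module.lin_dep class_ring (module_vec TYPE(real) N) (set bs)"
    "LinearCombinations.module.span class_ring (module_vec TYPE(real) N) (set bs)
       = {v \<in> carrier_vec N. v \<bullet> a = 0}"
proof -
  interpret vec_space "TYPE(real)" N .
  let ?B = "mat_of_cols N bs"
  have bsc: "set bs \<subseteq> carrier_vec N" using bs(1) by (simp add: indep_list_def)
  have B: "?B \<in> carrier_mat N (length bs)" by simp
  have colsB: "cols ?B = bs" using bsc by simp
  have aa: "a \<bullet> a \<noteq> 0" using conjugate_square_greater_0_vec[OF a(1)] a(2) by simp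
  have "N > 0"
  proof (rule ccontr)
    assume "\<not> N > 0"
    then have "a = 0\<^sub>v N" using a(1) by (intro eq_vecI) auto
    with a(2) show False by simp
  qed
  show "\<not> lin_dep (set bs)"
  proof
    assume ld: "lin_dep (set bs)"
    obtain c where "c \<in> carrier_vec (length bs)" "c \<noteq> 0\<^sub>v (length bs)" "?B *\<^sub>v c = 0\<^sub>v N"
      by (rule lin_depE[OF B, unfolded colsB, OF ld indep_list_distinct[OF bs(1)]])
    with bs(1) show False by (simp add: indep_list_def)
  qed
  have "col_space ?B = {y\<in>carrier_vec N. \<exists>x\<in>carrier_vec (length bs). ?B *\<^sub>v x = y}"
    using col_space_eq[OF B] by (simp only: carrier_matD[OF B])
  then have sp: "span (set bs) = {y\<in>carrier_vec N. \<exists>x\<in>carrier_vec (length bs). ?B *\<^sub>v x = y}"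
    unfolding col_space_def colsB .
  have Bta: "transpose_mat ?B *\<^sub>v a = 0\<^sub>v (length bs)"
    by (rule eq_vecI) (use bs(3) bsc in \<open>auto simp: subset_iff\<close>)
  have ort: "(?B *\<^sub>v x) \<bullet> a = 0" if x: "x \<in> carrier_vec (length bs)" for x
  proof -
    have "(?B *\<^sub>v x) \<bullet> a = a \<bullet> (?B *\<^sub>v x)"
      using comm_scalar_prod[OF a(1), of "?B *\<^sub>v x"] B x by simp
    also have "\<dots> = (transpose_mat ?B *\<^sub>v a) \<bullet> x"
      using transpose_vec_mult_scalar[OF B x a(1)] by simp
    finally show ?thesis unfolding Bta using x by simp
  qed
  show "span (set bs) = {v \<in> carrier_vec N. v \<bullet> a = 0}"
  proof
    show "span (set bs) \<subseteq> {v \<in> carrier_vec N. v \<bullet> a = 0}" unfolding sp using ort by auto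
    show "{v \<in> carrier_vec N. v \<bullet> a = 0} \<subseteq> span (set bs)"
    proof safe
      fix v assume v: "v \<in> carrier_vec N" "v \<bullet> a = 0"
      have "indep_list N (bs @ [a])"
        using indep_list_snoc[OF bs(1) a(1) a(1) bs(3) aa] .
      then obtain c where c: "c \<in> carrier_vec N" "mat_of_cols N (bs @ [a]) *\<^sub>v c = v"
        using indep_list_spanning[of N "bs @ [a]" v] bs(2) \<open>N > 0\<close> v(1) by auto
      then have "c \<in> carrier_vec (Suc (length bs))" using bs(2) \<open>N > 0\<close> by simp
      then obtain x t where x: "x \<in> carrier_vec (length bs)"
        and "mat_of_cols N (bs @ [a]) *\<^sub>v c = ?B *\<^sub>v x + t \<cdot>\<^sub>v a"
        using mat_of_cols_snoc_mult[OF _ a(1), of c bs] by metis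
      then have xt: "x \<in> carrier_vec (length bs)" "v = ?B *\<^sub>v x + t \<cdot>\<^sub>v a" using c(2) by simp_all
      have "v \<bullet> a = t * (a \<bullet> a)"
        unfolding xt(2) using ort[OF xt(1)] a(1) mult_mat_vec_carrier[OF B xt(1)]
        by (subst add_scalar_prod_distrib[of _ N]) auto
      then have "t = 0" using v(2) aa by simp
      then have "v = ?B *\<^sub>v x" using xt(2) a(1) mult_mat_vec_carrier[OF B xt(1)] by auto
      with xt(1) v(1) show "v \<in> span (set bs)" unfolding sp by auto
    qed
  qed
qed

section \<open>Real symmetric matrices\<close>

text \<open>The characteristic polynomial has a complex root. The usual computation of the Hermitian form of an
  eigenvector with itself shows that this root is real, and a real root of the characteristic
  polynomial belongs to a real eigenvector.\<close>

lemma real_symmetric_eigenvector: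
  fixes A :: "real mat"
  assumes A: "A \<in> carrier_mat n n" and sym: "transpose_mat A = A" and "0 < n"
  obtains v e where "v \<in> carrier_vec n" "v \<noteq> 0\<^sub>v n" "A *\<^sub>v v = e \<cdot>\<^sub>v v"
proof -
  interpret of_real_hom: inj_comm_ring_hom "of_real :: real \<Rightarrow> complex"
    by (unfold_locales) auto
  let ?C = "map_mat complex_of_real A"
  have C: "?C \<in> carrier_mat n n" using A by simp
  obtain as where as: "char_poly ?C = (\<Prod>a\<leftarrow>as. [:- a, 1:])" "length as = n"
    using char_poly_factorized[OF C] by blast
  then obtain z where z: "poly (char_poly ?C) z = 0"
    using \<open>0 < n\<close> by (cases as) auto
  then obtain w where w: "w \<in> carrier_vec n" "w \<noteq> 0\<^sub>v n" "?C *\<^sub>v w = z \<cdot>\<^sub>v w"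
    using eigenvalue_root_char_poly[OF C] C unfolding eigenvalue_def eigenvector_def by auto
  have ww: "w \<bullet>c w \<noteq> 0" using w(1,2) conjugate_square_eq_0_vec by blast
  have Cw: "?C *\<^sub>v conjugate w = conjugate (?C *\<^sub>v w)"
    by (rule eq_vecI) (use A w(1) in \<open>auto simp: scalar_prod_def\<close>)
  have "z * (w \<bullet>c w) = (?C *\<^sub>v w) \<bullet>c w" using w by simp
  also have "\<dots> = w \<bullet> (?C *\<^sub>v conjugate w)"
  proof -
    have "transpose_mat ?C = ?C" using sym by (metis map_mat_transpose)
    then show ?thesis
      using transpose_vec_mult_scalar[OF C, of "conjugate w" w] w(1) by simp
  qed
  also have "\<dots> = cnj z * (w \<bullet>c w)" unfolding Cw w(3) using w(1) by (simp add: conjugate_smult_vec)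
  finally have "z = cnj z" using ww by simp
  then have "z = of_real (Re z)" by (metis Reals_cnj_iff of_real_Re)
  moreover have "char_poly ?C = map_poly of_real (char_poly A)"
    by (rule of_real_hom.char_poly_hom[OF A])
  ultimately have "of_real (poly (char_poly A) (Re z)) = (0 :: complex)"
    using z by (metis of_real_hom.poly_map_poly)
  then have "poly (char_poly A) (Re z) = 0" by simp
  then show thesis
    using eigenvalue_root_char_poly[OF A] A that unfolding eigenvalue_def eigenvector_def by auto
qed

text \<open>Deflation: given r orthonormal eigenvectors vs, complete them to an orthonormal basis by the columns
  of Q. The compressed matrix B = Q^T A Q is again symmetric. If y is an eigenvector of B, then x = Q y is
  an eigenvector of A, since A x - e x is orthogonal to the columns of Q by the choice of y and
  to vs because A leaves the span of vs invariant.\<close>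

lemma symmetric_eigenbasis:
  fixes A :: "real mat"
  assumes A: "A \<in> carrier_mat n n" and sym: "transpose_mat A = A" and "r \<le> n"
  shows "\<exists>vs. orthonormal n vs \<and> length vs = r \<and> (\<forall>v\<in>set vs. \<exists>e. A *\<^sub>v v = e \<cdot>\<^sub>v v)"
  using \<open>r \<le> n\<close>
proof (induction r)
  case 0
  show ?case by (intro exI[of _ "[]"]) (simp add: orthonormal_def)
next
  case (Suc r)
  then obtain vs where vs: "orthonormal n vs" "length vs = r"
      "\<And>v. v \<in> set vs \<Longrightarrow> \<exists>e. A *\<^sub>v v = e \<cdot>\<^sub>v v" by auto
  obtain ws where ws: "orthonormal n (vs @ ws)" "length (vs @ ws) = n"
    by (rule orthonormal_extend[OF vs(1)])
  define q where "q = length ws"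
  define Q where "Q = mat_of_cols n ws"
  have Q: "Q \<in> carrier_mat n q" by (simp add: Q_def q_def)
  have carr: "set vs \<subseteq> carrier_vec n" "set ws \<subseteq> carrier_vec n"
    using ws(1) by (auto simp: orthonormal_def)
  have "orthonormal n ws" and ort: "\<And>v w. v \<in> set vs \<Longrightarrow> w \<in> set ws \<Longrightarrow> v \<bullet> w = 0"
    using ws(1) unfolding orthonormal_iff_set by auto
  then have QQ: "transpose_mat Q * Q = 1\<^sub>m q" using orthonormal_gram by (simp add: Q_def q_def)
  define B where "B = transpose_mat Q * (A * Q)"
  have B: "B \<in> carrier_mat q q" using Q A by (simp add: B_def)
  have "transpose_mat B = transpose_mat (A * Q) * Q"
    unfolding B_def using Q A by (subst transpose_mult[of _ q n]) auto
  also have "\<dots> = transpose_mat Q * A * Q"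
    using Q A by (subst transpose_mult[of _ n n]) (auto simp: sym)
  also have "\<dots> = B" unfolding B_def using Q A by (intro assoc_mult_mat) auto
  finally have "transpose_mat B = B" .
  moreover have "0 < q" using Suc(2) ws(2) vs(2) by (auto simp: q_def)
  ultimately obtain y e where y: "y \<in> carrier_vec q" "y \<noteq> 0\<^sub>v q" "B *\<^sub>v y = e \<cdot>\<^sub>v y"
    using real_symmetric_eigenvector[OF B] by metis
  define x where "x = Q *\<^sub>v y"
  have x: "x \<in> carrier_vec n" using Q y by (simp add: x_def)
  have x0: "x \<noteq> 0\<^sub>v n" using gram_one_kernel[OF Q QQ y(1)] y(2) by (auto simp: x_def)
  have Ax: "A *\<^sub>v x \<in> carrier_vec n" using A x by simp
  have vx: "v \<bullet> x = 0" if "v \<in> set vs" for v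
  proof -
    have v: "v \<in> carrier_vec n" using that carr by auto
    have "transpose_mat Q *\<^sub>v v = 0\<^sub>v q"
    proof (rule eq_vecI)
      fix j assume "j < dim_vec (0\<^sub>v q :: real vec)"
      then have j: "j < length ws" by (simp add: q_def)
      then have "(transpose_mat Q *\<^sub>v v) $ j = ws ! j \<bullet> v"
        using carr(2) by (simp add: Q_def subset_iff)
      also have "\<dots> = v \<bullet> ws ! j" using carr(2) j comm_scalar_prod[OF _ v, of "ws ! j"] by (simp add: subset_iff)
      finally show "(transpose_mat Q *\<^sub>v v) $ j = 0\<^sub>v q $ j" using ort[OF that] j by (simp add: q_def)
    qed (use Q in simp)
    then show ?thesis
      using transpose_vec_mult_scalar[OF Q y(1) v] y(1) by (simp add: x_def)
  qed
  have "A *\<^sub>v x - e \<cdot>\<^sub>v x = 0\<^sub>v n"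
  proof (rule orthonormal_complete[OF ws])
    fix u assume "u \<in> set (vs @ ws)"
    then consider "u \<in> set vs" | "u \<in> set ws" by auto
    then show "u \<bullet> (A *\<^sub>v x - e \<cdot>\<^sub>v x) = 0"
    proof cases
      case 1
      then have u: "u \<in> carrier_vec n" using carr by auto
      obtain c where c: "A *\<^sub>v u = c \<cdot>\<^sub>v u" using vs(3)[OF 1] by blast
      have "u \<bullet> (A *\<^sub>v x) = (A *\<^sub>v u) \<bullet> x"
        using transpose_vec_mult_scalar[OF A x u] by (simp add: sym)
      also have "\<dots> = 0" unfolding c using vx[OF 1] u x by simp
      finally show ?thesis using vx[OF 1] u x Ax by (simp add: scalar_prod_minus_distrib[of _ n])
    next
      case 2
      then have u: "u \<in> carrier_vec n" using carr by auto
      from 2 obtain j where j: "j < q" "u = col Q j"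
        using carr(2) by (auto simp: Q_def q_def in_set_conv_nth subset_iff)
      have "u \<bullet> (A *\<^sub>v x) = (transpose_mat Q *\<^sub>v (A *\<^sub>v x)) $ j" using j Q by simp
      also have "transpose_mat Q *\<^sub>v (A *\<^sub>v x) = B *\<^sub>v y"
        unfolding x_def B_def using Q A y(1) by (simp add: assoc_mult_mat_vec[of _ q n _ q] assoc_mult_mat_vec[of _ n n _ q])
      also have "(B *\<^sub>v y) $ j = e * y $ j" using y j by simp
      finally have 1: "u \<bullet> (A *\<^sub>v x) = e * y $ j" .
      have "u \<bullet> x = (transpose_mat Q *\<^sub>v x) $ j" using j Q by simp
      also have "transpose_mat Q *\<^sub>v x = y"
        unfolding x_def by (rule gram_one_cancel[OF Q QQ y(1)])
      finally show ?thesis using 1 u x Ax by (simp add: scalar_prod_minus_distrib[of _ n])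
    qed
  qed (use x Ax in auto)
  then have diff: "(A *\<^sub>v x - e \<cdot>\<^sub>v x) $ i = 0\<^sub>v n $ i" for i by simp
  have "A *\<^sub>v x = e \<cdot>\<^sub>v x"
  proof (rule eq_vecI)
    fix i assume "i < dim_vec (e \<cdot>\<^sub>v x)"
    then show "(A *\<^sub>v x) $ i = (e \<cdot>\<^sub>v x) $ i" using diff[of i] x A by simp
  qed (use x A in simp)
  then have "A *\<^sub>v ((1 / sqrt (x \<bullet> x)) \<cdot>\<^sub>v x) = e \<cdot>\<^sub>v ((1 / sqrt (x \<bullet> x)) \<cdot>\<^sub>v x)"
    using mult_mat_vec[OF A x] by (simp add: smult_smult_assoc mult.commute)
  then show ?case
    using orthonormal_snoc[OF vs(1) x x0 vx] vs(2,3)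
    by (intro exI[of _ "vs @ [(1 / sqrt (x \<bullet> x)) \<cdot>\<^sub>v x]"]) auto
qed

section \<open>Existence of singular value decompositions\<close>

lemma diagonal_factorization_index:
  fixes U :: "real mat"
  assumes U: "U \<in> carrier_mat m p" and S: "S \<in> carrier_mat p q" "diagonal_mat S"
    and V: "V \<in> carrier_mat k q" and ij: "i < m" "j < k"
  shows "(U * S * transpose_mat V) $$ (i, j) = (\<Sum>l<min p q. S $$ (l, l) * U $$ (i, l) * V $$ (j, l))"
proof -
  define W where "W = U * S"
  have W: "W \<in> carrier_mat m q" using U S by (simp add: W_def)
  have US: "W $$ (i, l) = (if l < p then U $$ (i, l) * S $$ (l, l) else 0)" if "l < q" for l
  proof -
    have "W $$ (i, l) = (\<Sum>t<p. U $$ (i, t) * S $$ (t, l))"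
      using U S ij that by (simp add: W_def scalar_prod_def atLeast0LessThan)
    also have "\<dots> = (\<Sum>t<p. if t = l then U $$ (i, l) * S $$ (l, l) else 0)"
      by (rule sum.cong) (use S that in \<open>auto simp: diagonal_mat_def\<close>)
    finally show ?thesis by simp
  qed
  have "(U * S * transpose_mat V) $$ (i, j) = (\<Sum>l<q. W $$ (i, l) * V $$ (j, l))"
    unfolding W_def[symmetric] using W V ij by (simp add: scalar_prod_def atLeast0LessThan)
  also have "\<dots> = (\<Sum>l<q. if l < p then S $$ (l, l) * U $$ (i, l) * V $$ (j, l) else 0)"
    by (rule sum.cong) (auto simp: US)
  also have "\<dots> = (\<Sum>l\<in>{..<q} \<inter> {..<p}. S $$ (l, l) * U $$ (i, l) * V $$ (j, l))"
    by (simp add: sum.If_cases lessThan_def)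
  also have "{..<q} \<inter> {..<p} = {..<min p q}" by auto
  finally show ?thesis .
qed

text \<open>Orthonormal eigenvectors of M^T M have orthogonal images under M. Sorting them by the length of the image
  prepares the decreasing order of the singular values.\<close>

lemma gram_eigenbasis_sorted:
  fixes M :: "real mat"
  assumes M: "M \<in> carrier_mat m k"
  obtains ws where "orthonormal k ws" "length ws = k"
    "\<And>u v. u \<in> set ws \<Longrightarrow> v \<in> set ws \<Longrightarrow> u \<noteq> v \<Longrightarrow> (M *\<^sub>v u) \<bullet> (M *\<^sub>v v) = 0"
    "\<And>i j. i \<le> j \<Longrightarrow> j < k \<Longrightarrow> (M *\<^sub>v ws ! j) \<bullet> (M *\<^sub>v ws ! j) \<le> (M *\<^sub>v ws ! i) \<bullet> (M *\<^sub>v ws ! i)"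
proof -
  let ?A = "transpose_mat M * M"
  have A: "?A \<in> carrier_mat k k" using M by simp
  have "transpose_mat ?A = ?A" using M by (subst transpose_mult[of _ k m]) auto
  then obtain vs where vs: "orthonormal k vs" "length vs = k"
      "\<And>v. v \<in> set vs \<Longrightarrow> \<exists>e. ?A *\<^sub>v v = e \<cdot>\<^sub>v v"
    using symmetric_eigenbasis[OF A _ le_refl] by auto
  define ws where "ws = sort_key (\<lambda>v. - ((M *\<^sub>v v) \<bullet> (M *\<^sub>v v))) vs"
  have set: "set ws = set vs" by (simp add: ws_def)
  have o: "orthonormal k ws" and len: "length ws = k"
    using vs(1,2) unfolding orthonormal_iff_set by (auto simp: ws_def)
  have ort: "(M *\<^sub>v u) \<bullet> (M *\<^sub>v v) = 0" if uv': "u \<in> set ws" "v \<in> set ws" "u \<noteq> v" for u v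
  proof -
    have uv: "u \<in> carrier_vec k" "v \<in> carrier_vec k" "v \<bullet> u = 0"
      using vs(1) uv' unfolding orthonormal_iff_set set by auto
    obtain e where e: "?A *\<^sub>v u = e \<cdot>\<^sub>v u" using vs(3)[of u] uv'(1) unfolding set by blast
    have "(M *\<^sub>v u) \<bullet> (M *\<^sub>v v) = (transpose_mat M *\<^sub>v (M *\<^sub>v u)) \<bullet> v"
      using transpose_vec_mult_scalar[OF M uv(2), of "M *\<^sub>v u"] M uv(1) by simp
    also have "transpose_mat M *\<^sub>v (M *\<^sub>v u) = e \<cdot>\<^sub>v u"
      using e M uv(1) by (simp add: assoc_mult_mat_vec[of _ k m _ k])
    also have "\<dots> \<bullet> v = 0" using uv comm_scalar_prod[OF uv(1,2)] by simp
    finally show ?thesis .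
  qed
  have "sorted (map (\<lambda>v. - ((M *\<^sub>v v) \<bullet> (M *\<^sub>v v))) ws)" by (simp add: ws_def)
  then have "(M *\<^sub>v ws ! j) \<bullet> (M *\<^sub>v ws ! j) \<le> (M *\<^sub>v ws ! i) \<bullet> (M *\<^sub>v ws ! i)" if "i \<le> j" "j < k" for i j
    using sorted_nth_mono[of _ i j] that len by fastforce
  with o len ort that show thesis by blast
qed

text \<open>The right singular vectors ws are orthonormal eigenvectors of M^T M, sorted by decreasing d j, the
  squared length of the image y j of ws ! j. The first r images are nonzero; normalized, they are the first r
  left singular vectors, and any orthonormal completion supplies the others.\<close>

lemma full_svd_exists:
  assumes M: "M \<in> carrier_mat m k"
  obtains U S V where "full_svd M U S V"
proof -
  obtain ws where ws: "orthonormal k ws" "length ws = k"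
    and ort: "\<And>u v. u \<in> set ws \<Longrightarrow> v \<in> set ws \<Longrightarrow> u \<noteq> v \<Longrightarrow> (M *\<^sub>v u) \<bullet> (M *\<^sub>v v) = 0"
    and mono: "\<And>i j. i \<le> j \<Longrightarrow> j < k \<Longrightarrow>
      (M *\<^sub>v ws ! j) \<bullet> (M *\<^sub>v ws ! j) \<le> (M *\<^sub>v ws ! i) \<bullet> (M *\<^sub>v ws ! i)"
    using gram_eigenbasis_sorted[OF M] by blast
  have dist: "distinct ws" using ws(1) unfolding orthonormal_iff_set by blast
  have wsc: "ws ! j \<in> carrier_vec k" if "j < k" for j
    using ws that by (simp add: orthonormal_def subset_iff)
  define y where "y j = M *\<^sub>v ws ! j" for j
  have yc: "y j \<in> carrier_vec m" for j by (rule carrier_vecI) (use M in \<open>simp add: y_def\<close>)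
  define d where "d j = y j \<bullet> y j" for j
  have d0: "0 \<le> d j" for j
    using conjugate_square_greater_0_vec[OF yc[of j]] yc[of j] unfolding d_def
    by (cases "y j = 0\<^sub>v m") auto
  have dz: "y j = 0\<^sub>v m" if "d j = 0" for j
    using conjugate_square_greater_0_vec[OF yc[of j]] that unfolding d_def by force
  have dmono: "d j \<le> d i" if "i \<le> j" "j < k" for i j
    using mono[OF that] by (simp add: d_def y_def)
  have yort: "y i \<bullet> y j = 0" if "i < k" "j < k" "i \<noteq> j" for i j
    using ort[of "ws ! i" "ws ! j"] that ws(2) dist by (simp add: y_def nth_eq_iff_index_eq)
  define r where "r = (LEAST j. j = k \<or> d j = 0)"
  have r: "r = k \<or> d r = 0" unfolding r_def by (rule LeastI[of _ k]) simp
  have rk: "r \<le> k" unfolding r_def by (rule Least_le) simp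
  have dpos: "0 < d j" if "j < r" for j
    using not_less_Least[OF that[unfolded r_def]] d0[of j] by simp
  have dzero: "d j = 0" if "r \<le> j" "j < k" for j
    using r dmono[OF that] d0[of j] that by auto
  define us where "us = map (\<lambda>j. (1 / sqrt (d j)) \<cdot>\<^sub>v y j) [0..<r]"
  have us: "orthonormal m us"
    unfolding orthonormal_def
  proof (intro conjI allI impI)
    fix i j assume "i < length us" "j < length us"
    then have ij: "i < r" "j < r" by (simp_all add: us_def)
    have "us ! i \<bullet> us ! j = 1 / sqrt (d i) * (1 / sqrt (d j)) * (y i \<bullet> y j)"
      using ij yc[of i] yc[of j] by (simp add: us_def)
    also have "\<dots> = (if i = j then 1 else 0)"
    proof (cases "i = j")
      case True
      then show ?thesis using dpos[OF ij(1)] by (simp add: d_def[symmetric])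
    next
      case False
      then show ?thesis using yort[of i j] ij rk by simp
    qed
    finally show "us ! i \<bullet> us ! j = (if i = j then 1 else 0)" .
  qed (use yc in \<open>auto simp: us_def\<close>)
  obtain us' where us': "orthonormal m (us @ us')" "length (us @ us') = m"
    by (rule orthonormal_extend[OF us])
  define U where "U = mat_of_cols m (us @ us')"
  define V where "V = mat_of_cols k ws"
  define S where "S = mat m k (\<lambda>(i, j). if i = j then sqrt (d j) else 0)"
  have U: "U \<in> carrier_mat m m" using mat_of_cols_carrier(1)[of m "us @ us'"] us'(2) by (simp add: U_def)
  have V: "V \<in> carrier_mat k k" using mat_of_cols_carrier(1)[of k ws] ws(2) by (simp add: V_def)
  have S: "S \<in> carrier_mat m k" by (simp add: S_def)
  have UU: "transpose_mat U * U = 1\<^sub>m m" using orthonormal_gram[OF us'(1)] us'(2) by (simp add: U_def)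
  have VV: "transpose_mat V * V = 1\<^sub>m k" using orthonormal_gram[OF ws(1)] ws(2) by (simp add: V_def)
  have VV': "V * transpose_mat V = 1\<^sub>m k"
    using VV V by (intro mat_mult_left_right_inverse[of "transpose_mat V"]) auto
  have rm: "r \<le> m" using orthonormal_length[OF us] by (simp add: us_def)
  have "M * V = U * S"
  proof (rule eq_matI)
    fix i j assume "i < dim_row (U * S)" "j < dim_col (U * S)"
    then have ij: "i < m" "j < k" using U S by auto
    have "(M * V) $$ (i, j) = y j $ i"
      using M V ij wsc[of j] ws(2) by (simp add: V_def y_def)
    also have "\<dots> = (\<Sum>t<m. U $$ (i, t) * S $$ (t, j))"
    proof (cases "j < r")
      case True
      then have "U $$ (i, j) = 1 / sqrt (d j) * y j $ i"
        using ij rm us'(2) yc[of j] by (simp add: U_def mat_of_cols_index nth_append us_def)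
      then have "y j $ i = (if j < m then U $$ (i, j) * sqrt (d j) else 0)"
        using dpos[OF True] True rm by simp
      also have "\<dots> = (\<Sum>t<m. if t = j then U $$ (i, j) * sqrt (d j) else 0)" by simp
      also have "\<dots> = (\<Sum>t<m. U $$ (i, t) * S $$ (t, j))"
        by (rule sum.cong) (use ij in \<open>auto simp: S_def\<close>)
      finally show ?thesis .
    next
      case False
      then have "d j = 0" using dzero ij by simp
      then show ?thesis using dz ij by (auto simp: S_def intro!: sum.neutral[symmetric])
    qed
    also have "\<dots> = (U * S) $$ (i, j)"
      using U S ij by (simp add: scalar_prod_def atLeast0LessThan)
    finally show "(M * V) $$ (i, j) = (U * S) $$ (i, j)" .
  qed (use M U V S in auto)
  then have "M = U * S * transpose_mat V"
    using M V VV' U S by (metis assoc_mult_mat right_mult_one_mat transpose_carrier_mat)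
  moreover have "diagonal_mat S" by (simp add: S_def diagonal_mat_def)
  ultimately have "full_svd M U S V"
    unfolding full_svd_def is_svd_def Let_def
    using M U S V UU VV d0 dmono by (auto simp: S_def)
  with that show thesis by blast
qed

text \<open>The columns of V beyond the m-th only meet zero columns of S and can be dropped.\<close>

lemma economical_svd_exists:
  assumes M: "M \<in> carrier_mat m k" and "m \<le> k"
  obtains U S V where "economical_svd M U S V"
proof -
  obtain U S V where f: "full_svd M U S V" by (rule full_svd_exists[OF M])
  then have U: "U \<in> carrier_mat m m" and S: "S \<in> carrier_mat m k" and V: "V \<in> carrier_mat k k"
    and UU: "transpose_mat U * U = 1\<^sub>m m" and VV: "transpose_mat V * V = 1\<^sub>m k"
    and dS: "diagonal_mat S" and pos: "\<And>i. i < m \<Longrightarrow> 0 \<le> S $$ (i, i)"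
    and mono: "\<And>i j. i \<le> j \<Longrightarrow> j < m \<Longrightarrow> S $$ (j, j) \<le> S $$ (i, i)"
    and MS: "M = U * S * transpose_mat V"
    using M \<open>m \<le> k\<close> unfolding full_svd_def is_svd_def Let_def by auto
  define S' where "S' = mat m m (\<lambda>ij. S $$ ij)"
  define V' where "V' = mat k m (\<lambda>ij. V $$ ij)"
  have S': "S' \<in> carrier_mat m m" "diagonal_mat S'"
    using dS S \<open>m \<le> k\<close> by (auto simp: S'_def diagonal_mat_def)
  have V': "V' \<in> carrier_mat k m" by (simp add: V'_def)
  have colV: "col V' j = col V j" if "j < m" for j
    by (rule eq_vecI) (use that V \<open>m \<le> k\<close> in \<open>auto simp: V'_def\<close>)
  have "transpose_mat V' * V' = 1\<^sub>m m"
    by (rule eq_matI) (use V' colV gram_one_cols[OF V VV] \<open>m \<le> k\<close> in auto)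
  moreover have "M = U * S' * transpose_mat V'"
  proof (rule eq_matI)
    fix i j assume "i < dim_row (U * S' * transpose_mat V')" "j < dim_col (U * S' * transpose_mat V')"
    then have ij: "i < m" "j < k" using U V' by auto
    show "M $$ (i, j) = (U * S' * transpose_mat V') $$ (i, j)"
      unfolding MS diagonal_factorization_index[OF U S dS V ij]
        diagonal_factorization_index[OF U S' V' ij]
      using ij \<open>m \<le> k\<close> by (auto simp: S'_def V'_def intro!: sum.cong)
  qed (use M U V' in auto)
  ultimately have "economical_svd M U S' V'"
    unfolding economical_svd_def is_svd_def Let_def
    using M U S' V' UU \<open>m \<le> k\<close> pos mono by (auto simp: S'_def)
  with that show thesis by blast
qed

section \<open>Vectorized outer products\<close>

abbreviation vouter :: "nat list \<Rightarrow> real vec list \<Rightarrow> real vec" where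
  "vouter ns xs \<equiv> vectorize ns (outer xs)"

lemma mixed_radix_less:
  assumes "i < n" "j < (K :: nat)"
  shows "i + n * j < n * K"
proof -
  have "i + n * j < n * Suc j" using assms(1) by simp
  also have "\<dots> \<le> n * K" using assms(2) by (intro mult_le_mono2) simp
  finally show ?thesis .
qed

lemma mixed_radix_div_less:
  assumes "p < n * (K :: nat)"
  shows "p mod n < n" "p div n < K" "p = p mod n + n * (p div n)"
  using assms by (auto simp: less_mult_imp_div_less mult.commute intro!: mod_less_divisor Nat.gr0I)

lemma sum_mixed_radix:
  fixes f :: "nat \<Rightarrow> 'a :: comm_monoid_add"
  shows "(\<Sum>p<n * K. f p) = (\<Sum>i<n. \<Sum>j<K. f (i + n * j))"
proof -
  have "(\<Sum>p<n * K. f p) = (\<Sum>(i, j)\<in>{..<n} \<times> {..<K}. f (i + n * j))"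
    by (rule sum.reindex_bij_witness[of _ "\<lambda>(i, j). i + n * j" "\<lambda>p. (p mod n, p div n)"])
      (auto simp: mixed_radix_less mixed_radix_div_less)
  then show ?thesis by (simp add: sum.cartesian_product)
qed

lemma tensor_indices_Nil: "tensor_indices [] = {[]}"
  by (simp add: tensor_indices_def)

lemma tensor_indices_Cons:
  "tensor_indices (n # ns) = (\<lambda>(i, is). i # is) ` ({..<n} \<times> tensor_indices ns)"
  by (auto simp: tensor_indices_def list_all2_Cons2)

lemma finite_tensor_indices: "finite (tensor_indices ns)"
  by (induction ns) (simp_all add: tensor_indices_Nil tensor_indices_Cons)

lemma sum_tensor_indices:
  fixes f :: "nat list \<Rightarrow> real"
  shows "(\<Sum>is\<in>tensor_indices ns. f is) = (\<Sum>p<prod_list ns. f (multi_index ns p))"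
proof (induction ns arbitrary: f)
  case Nil
  then show ?case by (simp add: tensor_indices_def)
next
  case (Cons n ns)
  have "inj_on (\<lambda>(i, is). i # is) ({..<n} \<times> tensor_indices ns)"
    by (auto simp: inj_on_def)
  then have "(\<Sum>is\<in>tensor_indices (n # ns). f is)
      = (\<Sum>(i, is)\<in>{..<n} \<times> tensor_indices ns. f (i # is))"
    by (simp add: tensor_indices_Cons sum.reindex case_prod_unfold)
  also have "\<dots> = (\<Sum>i<n. \<Sum>is\<in>tensor_indices ns. f (i # is))" by (simp add: sum.cartesian_product)
  also have "\<dots> = (\<Sum>i<n. \<Sum>j<prod_list ns. f (multi_index (n # ns) (i + n * j)))"
    unfolding Cons by (intro sum.cong) auto
  finally show ?case by (simp add: sum_mixed_radix)
qed

lemma vectorize_carrier [simp]: "vectorize ns A \<in> carrier_vec (prod_list ns)"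
  by (simp add: vectorize_def)

lemma dim_vec_vectorize [simp]: "dim_vec (vectorize ns A) = prod_list ns"
  by (simp add: vectorize_def)

lemma tensor_inner_vectorize: "tensor_inner ns A B = vectorize ns A \<bullet> vectorize ns B"
  by (simp add: tensor_inner_def sum_tensor_indices scalar_prod_def vectorize_def atLeast0LessThan)

lemma vectorize_nonzero:
  assumes "\<exists>is\<in>tensor_indices ns. A is \<noteq> 0"
  shows "vectorize ns A \<noteq> 0\<^sub>v (prod_list ns)"
proof
  assume 0: "vectorize ns A = 0\<^sub>v (prod_list ns)"
  have "A (multi_index ns p) = 0" if "p < prod_list ns" for p
  proof -
    have "A (multi_index ns p) = vectorize ns A $ p" using that by (simp add: vectorize_def)
    then show ?thesis unfolding 0 using that by simp
  qed
  then have "(\<Sum>is\<in>tensor_indices ns. (A is)\<^sup>2) = 0" by (simp add: sum_tensor_indices)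
  then show False using assms by (auto simp: sum_nonneg_eq_0_iff finite_tensor_indices)
qed

lemma scalar_prod_mixed_radix:
  assumes "v \<in> carrier_vec (n * K)"
  shows "u \<bullet> v = (\<Sum>i<n. \<Sum>j<K. u $ (i + n * j) * v $ (i + n * j))"
  using assms by (simp add: scalar_prod_def atLeast0LessThan sum_mixed_radix)

lemma mode_vectors_Nil: "mode_vectors [] xs \<longleftrightarrow> xs = []"
  by (auto simp: mode_vectors_def)

lemma mode_vectors_Cons:
  "mode_vectors (n # ns) (x # xs) \<longleftrightarrow> x \<in> carrier_vec n \<and> mode_vectors ns xs"
  by (simp add: mode_vectors_def)

lemma mode_vectors_ConsE:
  assumes "mode_vectors (n # ns) zs"
  obtains x xs where "zs = x # xs" "x \<in> carrier_vec n" "mode_vectors ns xs"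
  using assms by (auto simp: mode_vectors_def list_all2_Cons2)

lemma outer_Cons: "outer (x # xs) (i # is) = x $ i * outer xs is"
  by (simp add: outer_def prod.lessThan_Suc_shift del: prod.lessThan_Suc)

lemma vouter_Cons_index:
  assumes "i < n" "j < prod_list ns"
  shows "vouter (n # ns) (x # xs) $ (i + n * j) = x $ i * vouter ns xs $ j"
  using assms mixed_radix_less[OF assms]
  by (simp add: vectorize_def outer_Cons)

text \<open>The scalar product of outer products is the product of the scalar products of the mode vectors; this
  is why orthonormality is inherited along the tree of singular value decompositions.\<close>

lemma vouter_inner_Cons:
  assumes "x \<in> carrier_vec n" "y \<in> carrier_vec n"
  shows "vouter (n # ns) (x # xs) \<bullet> vouter (n # ns) (y # ys) = (x \<bullet> y) * (vouter ns xs \<bullet> vouter ns ys)"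
proof -
  let ?K = "prod_list ns"
  have "vouter (n # ns) (x # xs) \<bullet> vouter (n # ns) (y # ys)
      = (\<Sum>i<n. \<Sum>j<?K. (x $ i * y $ i) * (vouter ns xs $ j * vouter ns ys $ j))"
    using vectorize_carrier[of "n # ns" "outer (y # ys)"]
    by (subst scalar_prod_mixed_radix[of _ n ?K]) (auto simp: vouter_Cons_index intro!: sum.cong)
  also have "\<dots> = (\<Sum>i<n. x $ i * y $ i) * (\<Sum>j<?K. vouter ns xs $ j * vouter ns ys $ j)"
    by (simp add: sum_product)
  also have "\<dots> = (x \<bullet> y) * (vouter ns xs \<bullet> vouter ns ys)"
    using assms(2) by (simp add: scalar_prod_def atLeast0LessThan)
  finally show ?thesis .
qed

text \<open>Contraction of the first mode, of dimension n, of the vectorized tensor a with the vector x.\<close>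

definition contract :: "nat \<Rightarrow> nat \<Rightarrow> real vec \<Rightarrow> real vec \<Rightarrow> real vec" where
  "contract n K a x = vec K (\<lambda>j. \<Sum>i<n. x $ i * a $ (i + n * j))"

lemma contract_carrier [simp]: "contract n K a x \<in> carrier_vec K"
  by (simp add: contract_def)

lemma inner_vouter_Cons:
  "a \<bullet> vouter (n # ns) (x # xs) = contract n (prod_list ns) a x \<bullet> vouter ns xs"
proof -
  let ?K = "prod_list ns"
  have "a \<bullet> vouter (n # ns) (x # xs) = (\<Sum>i<n. \<Sum>j<?K. x $ i * a $ (i + n * j) * vouter ns xs $ j)"
    using vectorize_carrier[of "n # ns" "outer (x # xs)"]
    by (subst scalar_prod_mixed_radix[of _ n ?K]) (auto simp: vouter_Cons_index intro!: sum.cong)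
  also have "\<dots> = (\<Sum>j<?K. \<Sum>i<n. x $ i * a $ (i + n * j) * vouter ns xs $ j)" by (rule sum.swap)
  also have "\<dots> = contract n ?K a x \<bullet> vouter ns xs"
    by (simp add: scalar_prod_def atLeast0LessThan contract_def sum_distrib_right)
  finally show ?thesis .
qed

lemma contract_add:
  assumes "x \<in> carrier_vec n" "y \<in> carrier_vec n"
  shows "contract n K a (x + y) = contract n K a x + contract n K a y"
  by (rule eq_vecI) (use assms in \<open>auto simp: contract_def algebra_simps sum.distrib\<close>)

lemma contract_smult:
  assumes "x \<in> carrier_vec n"
  shows "contract n K a (c \<cdot>\<^sub>v x) = c \<cdot>\<^sub>v contract n K a x"
  by (rule eq_vecI) (use assms in \<open>auto simp: contract_def algebra_simps sum_distrib_left\<close>)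

lemma contract_unit:
  assumes "i < n" "j < K"
  shows "contract n K a (unit_vec n i) $ j = a $ (i + n * j)"
proof -
  have "contract n K a (unit_vec n i) $ j = (\<Sum>t<n. unit_vec n i $ t * a $ (t + n * j))"
    using assms by (simp add: contract_def)
  also have "\<dots> = (\<Sum>t<n. if t = i then a $ (i + n * j) else 0)"
    by (rule sum.cong) (use assms in auto)
  finally have "contract n K a (unit_vec n i) $ j = \<dots>" .
  then show ?thesis using assms by simp
qed

lemma eq_vec_mixed_radix:
  assumes "a \<in> carrier_vec (n * K)" "b \<in> carrier_vec (n * K)"
    and "\<And>i j. i < n \<Longrightarrow> j < K \<Longrightarrow> a $ (i + n * j) = b $ (i + n * j)"
  shows "a = b"
proof (rule eq_vecI)
  fix p assume "p < dim_vec b"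
  then have p: "p < n * K" using assms(2) by simp
  show "a $ p = b $ p"
    using assms(3)[OF mixed_radix_div_less(1,2)[OF p]] mixed_radix_div_less(3)[OF p] by simp
qed (use assms in simp)

text \<open>Outer products span the whole space. Contracting the first mode with a unit vector selects a slice,
  to which induction on the number of modes applies.\<close>

lemma vouter_separating:
  assumes "v \<in> carrier_vec (prod_list ns)"
    and "\<And>xs. mode_vectors ns xs \<Longrightarrow> v \<bullet> vouter ns xs = 0"
  shows "v = 0\<^sub>v (prod_list ns)"
  using assms
proof (induction ns arbitrary: v)
  case Nil
  from Nil(2)[of "[]"] Nil(1) show ?case
    by (intro eq_vecI) (auto simp: mode_vectors_Nil vectorize_def outer_def scalar_prod_def)
next
  case (Cons n ns)
  let ?K = "prod_list ns"
  have c: "contract n ?K v (unit_vec n i) = 0\<^sub>v ?K" if "i < n" for i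
  proof (rule Cons.IH)
    fix xs assume "mode_vectors ns xs"
    then show "contract n ?K v (unit_vec n i) \<bullet> vouter ns xs = 0"
      using Cons(3)[of "unit_vec n i # xs"] by (simp add: mode_vectors_Cons inner_vouter_Cons)
  qed simp
  have "v = 0\<^sub>v (n * ?K)"
  proof (rule eq_vec_mixed_radix)
    fix i j assume ij: "i < n" "j < ?K"
    then show "v $ (i + n * j) = 0\<^sub>v (n * ?K) $ (i + n * j)"
      using contract_unit[OF ij, of v] c[OF ij(1)] mixed_radix_less[OF ij] by simp
  qed (use Cons(2) in simp_all)
  then show ?case by simp
qed

text \<open>The outer products in the hyperplane orthogonal to a are numerous enough to determine the line through a:
  a multilinear form b that vanishes wherever the multilinear form a vanishes is a multiple of a.

  Write \<open>\<alpha> x\<close> and \<open>\<beta> x\<close> for the contractions of a and b with x in the first mode.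
  By induction, or by the separating property when \<open>\<alpha> x = 0\<close>, each \<open>\<beta> x\<close> is a multiple of
  \<open>\<alpha> x\<close>, with a factor that may depend on x. To see that it does not, fix mode vectors ys of the other
  modes on which a does not vanish identically in x. In the first mode alone the claim is the elementary fact about
  two linear functionals f and g, which gives a constant c with g = c f. Hence the factor is c wherever f is nonzero;
  every other x is a difference of two vectors where f is nonzero.\<close>

lemma rank_one_annihilator:
  assumes "a \<in> carrier_vec (prod_list ns)" "b \<in> carrier_vec (prod_list ns)"
    and "a \<noteq> 0\<^sub>v (prod_list ns)"
    and "\<And>xs. mode_vectors ns xs \<Longrightarrow> a \<bullet> vouter ns xs = 0 \<Longrightarrow> b \<bullet> vouter ns xs = 0"
  shows "\<exists>c. b = c \<cdot>\<^sub>v a"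
  using assms
proof (induction ns arbitrary: a b)
  case Nil
  have "a $ 0 \<noteq> 0"
  proof
    assume "a $ 0 = 0"
    then have "a = 0\<^sub>v 1" using Nil(1) by (intro eq_vecI) auto
    with Nil(3) show False by simp
  qed
  then have "b = (b $ 0 / a $ 0) \<cdot>\<^sub>v a" using Nil(1,2) by (intro eq_vecI) auto
  then show ?case ..
next
  case (Cons n ns)
  let ?K = "prod_list ns"
  define \<alpha> \<beta> where "\<alpha> = contract n ?K a" and "\<beta> = contract n ?K b"
  have carr: "\<alpha> x \<in> carrier_vec ?K" "\<beta> x \<in> carrier_vec ?K" for x by (simp_all add: \<alpha>_def \<beta>_def)
  have ann: "\<beta> x \<bullet> vouter ns ys = 0"
    if "x \<in> carrier_vec n" "mode_vectors ns ys" "\<alpha> x \<bullet> vouter ns ys = 0" for x ys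
    using Cons(5)[of "x # ys"] that by (simp add: mode_vectors_Cons inner_vouter_Cons \<alpha>_def \<beta>_def)
  have proportional: "\<exists>c. \<beta> x = c \<cdot>\<^sub>v \<alpha> x" if x: "x \<in> carrier_vec n" for x
  proof (cases "\<alpha> x = 0\<^sub>v ?K")
    case True
    then have "\<beta> x = 0\<^sub>v ?K"
      using vouter_separating[OF carr(2)[of x]] ann[OF x] by simp
    with True show ?thesis by (intro exI[of _ 0] eq_vecI) auto
  next
    case False
    show ?thesis using Cons.IH[OF carr False ann[OF x]] .
  qed
  obtain zs where zs: "mode_vectors (n # ns) zs" "a \<bullet> vouter (n # ns) zs \<noteq> 0"
    using vouter_separating[OF Cons(2)] Cons(4) by blast
  then obtain x0 ys where x0: "x0 \<in> carrier_vec n" and ys: "mode_vectors ns ys"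
    and "\<alpha> x0 \<bullet> vouter ns ys \<noteq> 0"
    by (auto elim!: mode_vectors_ConsE simp: inner_vouter_Cons \<alpha>_def)
  define f g where "f x = \<alpha> x \<bullet> vouter ns ys" and "g x = \<beta> x \<bullet> vouter ns ys" for x
  have f0: "f x0 \<noteq> 0" using \<open>\<alpha> x0 \<bullet> vouter ns ys \<noteq> 0\<close> by (simp add: f_def)
  define c where "c = g x0 / f x0"
  have lin: "f (x + t \<cdot>\<^sub>v x0) = f x + t * f x0" "g (x + t \<cdot>\<^sub>v x0) = g x + t * g x0"
    if "x \<in> carrier_vec n" for x t
    using that x0 carr vectorize_carrier[of ns "outer ys"]
    by (simp_all add: f_def g_def \<alpha>_def \<beta>_def contract_add contract_smult add_scalar_prod_distrib[of _ ?K])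
  have gf: "g x = c * f x" if x: "x \<in> carrier_vec n" for x
  proof -
    let ?x = "x + (- f x / f x0) \<cdot>\<^sub>v x0"
    have "f ?x = 0" using lin(1)[OF x] f0 by simp
    then have "g ?x = 0" using ann[OF _ ys, of ?x] x x0 by (simp add: f_def g_def)
    then show ?thesis using lin(2)[OF x] f0 by (simp add: c_def field_simps)
  qed
  have nz: "\<beta> x = c \<cdot>\<^sub>v \<alpha> x" if x: "x \<in> carrier_vec n" "f x \<noteq> 0" for x
  proof -
    obtain e where e: "\<beta> x = e \<cdot>\<^sub>v \<alpha> x" using proportional[OF x(1)] by blast
    have "g x = e * f x" unfolding g_def f_def e using carr vectorize_carrier[of ns "outer ys"] by simp
    then show ?thesis using e gf[OF x(1)] x(2) by simp
  qed
  have all: "\<beta> x = c \<cdot>\<^sub>v \<alpha> x" if x: "x \<in> carrier_vec n" for x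
  proof (cases "f x = 0")
    case True
    have "\<beta> (x + x0) = c \<cdot>\<^sub>v \<alpha> (x + x0)"
      using nz[of "x + x0"] lin(1)[OF x, of 1] True f0 x x0 by simp
    then have "\<beta> x + \<beta> x0 = c \<cdot>\<^sub>v \<alpha> x + c \<cdot>\<^sub>v \<alpha> x0"
      using x x0 carr by (simp add: \<alpha>_def \<beta>_def contract_add smult_add_distrib_vec[of _ ?K])
    then have sum: "\<beta> x + \<beta> x0 = c \<cdot>\<^sub>v \<alpha> x + \<beta> x0" using nz[OF x0 f0] by simp
    show ?thesis
    proof (rule eq_vecI)
      fix j assume "j < dim_vec (c \<cdot>\<^sub>v \<alpha> x)"
      then show "\<beta> x $ j = (c \<cdot>\<^sub>v \<alpha> x) $ j"
        using arg_cong[OF sum, of "\<lambda>v. v $ j"] carr[of x] carr[of x0] by simp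
    qed (use carr[of x] in simp)
  next
    case False
    then show ?thesis using nz x by blast
  qed
  have "b = c \<cdot>\<^sub>v a"
  proof (rule eq_vec_mixed_radix[of _ n ?K])
    fix i j assume ij: "i < n" "j < ?K"
    have "\<beta> (unit_vec n i) $ j = c * \<alpha> (unit_vec n i) $ j"
      using all[of "unit_vec n i"] ij carr(1)[of "unit_vec n i"] by simp
    then show "b $ (i + n * j) = (c \<cdot>\<^sub>v a) $ (i + n * j)"
      using Cons(2) ij mixed_radix_less[OF ij] by (simp add: \<alpha>_def \<beta>_def contract_unit)
  qed (use Cons(2,3) in simp_all)
  then show ?case ..
qed

section \<open>Outer products span the orthogonal complement\<close>

text \<open>Duality between spanning and annihilators, in the form of a greedy choice. If fewer than N - 1 vectors of S
  have been chosen, some nonzero b is orthogonal to all of them and to a. By hypothesis b does not annihilate S, and a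
  vector of S with nonzero scalar product with b extends the choice.\<close>

lemma indep_list_exists_of_annihilator:
  assumes S: "S \<subseteq> carrier_vec N" and a: "a \<in> carrier_vec N" and "r \<le> N - 1"
    and ann: "\<And>b. b \<in> carrier_vec N \<Longrightarrow> a \<bullet> b = 0 \<Longrightarrow> (\<And>s. s \<in> S \<Longrightarrow> s \<bullet> b = 0) \<Longrightarrow> b = 0\<^sub>v N"
  shows "\<exists>bs. set bs \<subseteq> S \<and> length bs = r \<and> indep_list N bs"
  using \<open>r \<le> N - 1\<close>
proof (induction r)
  case 0
  show ?case by (intro exI[of _ "[]"]) (auto simp: indep_list_def)
next
  case (Suc r)
  then obtain bs where bs: "set bs \<subseteq> S" "length bs = r" "indep_list N bs" by auto
  have bsc: "set bs \<subseteq> carrier_vec N" using bs(1) S by blast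
  have M: "mat_of_rows N (bs @ [a]) \<in> carrier_mat (Suc r) N"
    using mat_of_rows_carrier(1)[of N "bs @ [a]"] bs(2) by simp
  have "Suc r < N" using Suc(2) by simp
  obtain b where b: "b \<in> carrier_vec N" "b \<noteq> 0\<^sub>v N"
      "mat_of_rows N (bs @ [a]) *\<^sub>v b = 0\<^sub>v (Suc r)"
    by (rule wide_matrix_kernel[OF M \<open>Suc r < N\<close>])
  have ort: "u \<bullet> b = 0" if u: "u \<in> set (bs @ [a])" for u
  proof -
    obtain i where i: "i < Suc r" "(bs @ [a]) ! i = u"
      using u bs(2) by (metis in_set_conv_nth length_append_singleton)
    have "u \<in> carrier_vec N" using u bsc a by auto
    then have "u \<bullet> b = (mat_of_rows N (bs @ [a]) *\<^sub>v b) $ i" using i bs(2) by simp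
    then show ?thesis unfolding b(3) using i by simp
  qed
  obtain s where s: "s \<in> S" "s \<bullet> b \<noteq> 0"
    using ann[OF b(1)] b(2) ort[of a] by auto
  have "indep_list N (bs @ [s])"
    using indep_list_snoc[OF bs(3) _ b(1) _ s(2)] s(1) S ort by auto
  then show ?case using bs s by (intro exI[of _ "bs @ [s]"]) auto
qed

lemma basis_of_hyperplane:
  assumes a: "a \<in> carrier_vec N" "a \<noteq> 0\<^sub>v N"
    and bs: "indep_list N bs" "length bs = N - 1" "\<And>b. b \<in> set bs \<Longrightarrow> b \<bullet> a = 0"
  defines "W \<equiv> {v \<in> carrier_vec N. v \<bullet> a = 0}"
  shows "basis_of N W bs" "subspace class_ring W (module_vec TYPE(real) N)"
    "vectorspace.dim class_ring ((module_vec TYPE(real) N)\<lparr>carrier := W\<rparr>) = N - 1"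
proof -
  interpret vec_space "TYPE(real)" N .
  have bsc: "set bs \<subseteq> carrier_vec N" using bs(1) by (simp add: indep_list_def)
  have li: "\<not> lin_dep (set bs)" and sp: "span (set bs) = W"
    using hyperplane_basis[OF a bs] by (simp_all add: W_def)
  show sub: "subspace class_ring W V"
    using span_is_subspace[of "set bs"] bsc unfolding sp by simp
  then have subm: "submodule class_ring W V" and vs: "vectorspace class_ring (V\<lparr>carrier := W\<rparr>)"
    by (simp_all add: subspace_is_vs)
  have bsW: "set bs \<subseteq> W" using bsc bs(3) by (auto simp: W_def)
  have basis: "vectorspace.basis class_ring (V\<lparr>carrier := W\<rparr>) (set bs)"
    unfolding vectorspace.basis_def[OF vs]
    using span_li_not_depend[OF bsW subm] li sp bsW by simp
  then show "basis_of N W bs" using indep_list_distinct[OF bs(1)] by (simp add: basis_of_def)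
  show "vectorspace.dim class_ring (V\<lparr>carrier := W\<rparr>) = N - 1"
    using vectorspace.dim_basis[OF vs _ basis] distinct_card[OF indep_list_distinct[OF bs(1)]] bs(2)
    by simp
qed

text \<open>A vector b that annihilates all outer products of the hyperplane is a multiple of the normal vector; if it
  also lies in the hyperplane, it is zero. So the greedy choice applies to outer products.\<close>

lemma rank_one_hyperplane_basis:
  assumes "vectorize ns A \<noteq> 0\<^sub>v (prod_list ns)"
  obtains bs where "indep_list (prod_list ns) bs" "length bs = prod_list ns - 1"
    "set bs \<subseteq> {vouter ns xs | xs. mode_vectors ns xs \<and> tensor_inner ns A (outer xs) = 0}"
proof -
  let ?N = "prod_list ns" and ?a = "vectorize ns A"
  let ?S = "{vouter ns xs | xs. mode_vectors ns xs \<and> tensor_inner ns A (outer xs) = 0}"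
  have "\<exists>bs. set bs \<subseteq> ?S \<and> length bs = ?N - 1 \<and> indep_list ?N bs"
  proof (rule indep_list_exists_of_annihilator[of _ _ ?a])
    fix b assume b: "b \<in> carrier_vec ?N" "?a \<bullet> b = 0" "\<And>s. s \<in> ?S \<Longrightarrow> s \<bullet> b = 0"
    have "b \<bullet> vouter ns xs = 0" if "mode_vectors ns xs" "?a \<bullet> vouter ns xs = 0" for xs
      using b(3)[of "vouter ns xs"] that comm_scalar_prod[OF b(1), of "vouter ns xs"]
      by (auto simp: tensor_inner_vectorize)
    then obtain c where c: "b = c \<cdot>\<^sub>v ?a"
      using rank_one_annihilator[OF _ b(1) assms] by auto
    have "b \<bullet> b = c * (?a \<bullet> b)" using b(1) by (subst c) simp
    then have "b \<bullet> b = 0" using b(2) by simp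
    then show "b = 0\<^sub>v ?N" using conjugate_square_eq_0_vec[OF b(1)] by simp
  qed auto
  then obtain bs where "set bs \<subseteq> ?S" "length bs = ?N - 1" "indep_list ?N bs" by blast
  with that show thesis by blast
qed

lemma opspan_perp_eq_hyperplane:
  assumes a: "vectorize ns A \<noteq> 0\<^sub>v (prod_list ns)"
  shows "opspan_perp ns A = {v \<in> carrier_vec (prod_list ns). v \<bullet> vectorize ns A = 0}"
proof -
  let ?N = "prod_list ns" and ?a = "vectorize ns A"
  interpret vec_space "TYPE(real)" "prod_list ns" .
  let ?S = "{vouter ns xs | xs. mode_vectors ns xs \<and> tensor_inner ns A (outer xs) = 0}"
  let ?W = "{v \<in> carrier_vec ?N. v \<bullet> ?a = 0}"
  obtain bs where bs: "indep_list ?N bs" "length bs = ?N - 1"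
    and bsS: "set bs \<subseteq> ?S"
    by (rule rank_one_hyperplane_basis[OF a])
  have SW: "?S \<subseteq> ?W"
    using comm_scalar_prod[of _ ?N ?a] by (auto simp: tensor_inner_vectorize)
  have ort: "b \<bullet> ?a = 0" if "b \<in> set bs" for b using SW bsS that by blast
  have "?W = span (set bs)" using hyperplane_basis(2)[OF _ a bs ort] by simp
  also have "\<dots> \<subseteq> span ?S" using span_is_monotone[OF bsS] .
  finally have "?W \<subseteq> span ?S" .
  moreover have "submodule class_ring ?W V"
    using basis_of_hyperplane(2)[OF _ a bs ort] by simp
  then have "span ?S \<subseteq> ?W" using span_is_subset[OF SW] by simp
  ultimately show ?thesis by (auto simp: opspan_perp_def)
qed

section \<open>The terms of the full decomposition\<close>

lemma reshape_carrier [simp]: "reshape m k a \<in> carrier_mat m k"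
  by (simp add: reshape_def)

text \<open>A left singular vector without a right singular vector of its own, which occurs when m exceeds the number
  of columns, is joined to the right singular vector with index 0; there is one because no dimension is 0.\<close>

lemma full_TTr1_exists:
  assumes "2 \<le> length ns" "0 \<notin> set ns"
  shows "\<exists>ts zs. full_TTr1 ns a ts zs"
  using assms
proof (induction ns arbitrary: a)
  case Nil
  then show ?case by simp
next
  case (Cons m ns)
  show ?case
  proof (cases "2 \<le> length ns")
    case False
    with Cons(2) have "length ns = 1" by simp
    then obtain n where ns: "ns = [n]" by (metis length_0_conv length_Suc_conv One_nat_def)
    obtain U S V where "full_svd (reshape m n a) U S V"
      by (rule full_svd_exists[OF reshape_carrier])
    from full_TTr1.last_level[OF this] show ?thesis unfolding ns by blast
  next
    case True
    let ?K = "prod_list ns"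
    have K: "0 < ?K" using Cons(3) by (induction ns) auto
    obtain U S V where svd: "full_svd (reshape m ?K a) U S V"
      by (rule full_svd_exists[OF reshape_carrier])
    then have dims: "dim_col U = m" "dim_col V = ?K"
      by (simp_all add: full_svd_def reshape_def)
    define c where "c i = (if i < ?K then i else 0)" for i
    have "\<forall>i. \<exists>ts zs. full_TTr1 ns (col V (c i)) ts zs" using Cons.IH True Cons(3) by auto
    then obtain ts zs where TT: "\<And>i. full_TTr1 ns (col V (c i)) (ts i) (zs i)" by metis
    have c: "\<forall>i<m. c i < dim_col V \<and> (i < ?K \<longrightarrow> c i = i)" using dims K by (auto simp: c_def)
    have "full_TTr1 (m # ns) a
       [(S $$ (i, i) * w, col U i # xs). i \<leftarrow> [0..<min m ?K], (w, xs) \<leftarrow> ts i]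
       ([col U i # xs. i \<leftarrow> [0..<m], xs \<leftarrow> zs i] @
        [col U i # xs. i \<leftarrow> [?K..<m], (w, xs) \<leftarrow> ts i])"
      by (rule full_TTr1.level[OF True _ dims(1) c]) (use svd TT in \<open>auto simp: full_svd_def\<close>)
    then show ?thesis by blast
  qed
qed

text \<open>Orthonormality is expressed by equality of the lists of mode vectors and not of the vectorized outer
  products, since distinctness of the former is easier to propagate along the recursion.\<close>

definition orthonormal_terms :: "nat list \<Rightarrow> real vec list list \<Rightarrow> bool" where
  "orthonormal_terms ns L \<longleftrightarrow> distinct L \<and> length L = prod_list ns \<and>
     (\<forall>xs\<in>set L. mode_vectors ns xs) \<and>
     (\<forall>xs\<in>set L. \<forall>ys\<in>set L. vouter ns xs \<bullet> vouter ns ys = (if xs = ys then 1 else 0))"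

lemma distinct_concat_map:
  assumes "distinct xs" "\<And>x. x \<in> set xs \<Longrightarrow> distinct (f x)"
    and "\<And>x y. x \<in> set xs \<Longrightarrow> y \<in> set xs \<Longrightarrow> x \<noteq> y \<Longrightarrow> set (f x) \<inter> set (f y) = {}"
  shows "distinct (concat (map f xs))"
  using assms by (induction xs) fastforce+

lemma sum_list_concat_map_upt:
  fixes g :: "'b \<Rightarrow> 'a :: comm_monoid_add"
  shows "sum_list (map g (concat (map f [0..<n]))) = (\<Sum>i<n. sum_list (map g (f i)))"
  by (induction n) simp_all

lemma set_diagonal_union_off_diagonal:
  "set (map (\<lambda>j. g j j) [0..<min m n]) \<union> set [g j k. j \<leftarrow> [0..<m], k \<leftarrow> [0..<n], j \<noteq> k]
    = {g j k | j k. j < m \<and> k < n}" (is "?D \<union> ?E = ?R")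
proof
  show "?D \<union> ?E \<subseteq> ?R" by (auto split: if_splits) blast+
  show "?R \<subseteq> ?D \<union> ?E"
  proof
    fix y assume "y \<in> ?R"
    then obtain j k where "y = g j k" "j < m" "k < n" by blast
    moreover from this have "j \<noteq> k \<Longrightarrow> y \<in> ?E"
      by (simp, intro bexI[of _ j] bexI[of _ k]) auto
    ultimately show "y \<in> ?D \<union> ?E" by (cases "j = k") auto
  qed
qed

lemma orthonormal_cols_inj:
  fixes U :: "real mat"
  assumes "U \<in> carrier_mat m p" "transpose_mat U * U = 1\<^sub>m p" "i < p" "j < p"
  shows "col U i = col U j \<longleftrightarrow> i = j"
  using gram_one_cols[OF assms] gram_one_cols[OF assms(1,2,3,3)] by (cases "i = j") auto

text \<open>One level of the recursion, independently of the order in which the terms are listed: an orthonormal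
  basis of the first mode, each of whose vectors is joined to some orthonormal basis of outer products of the other modes.
  These bases may differ from one vector to the next.\<close>

lemma orthonormal_terms_level:
  assumes U: "U \<in> carrier_mat m m" "transpose_mat U * U = 1\<^sub>m m"
    and L: "\<And>i. i < m \<Longrightarrow> orthonormal_terms ns (L i)"
    and M: "distinct M" "set M = {col U i # xs | i xs. i < m \<and> xs \<in> set (L i)}"
  shows "orthonormal_terms (m # ns) M"
proof -
  let ?f = "\<lambda>(i, xs). col U i # xs"
  have setM: "set M = ?f ` (SIGMA i:{..<m}. set (L i))" unfolding M(2) by auto
  have "inj_on ?f (SIGMA i:{..<m}. set (L i))"
    using orthonormal_cols_inj[OF U] by (auto simp: inj_on_def)
  then have "length M = card (SIGMA i:{..<m}. set (L i))"
    using distinct_card[OF M(1)] setM by (simp add: card_image)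
  also have "\<dots> = (\<Sum>i<m. card (set (L i)))" by simp
  also have "\<dots> = (\<Sum>i<m. prod_list ns)"
    by (rule sum.cong) (use L in \<open>auto simp: orthonormal_terms_def distinct_card\<close>)
  finally have len: "length M = prod_list (m # ns)" by simp
  have "mode_vectors (m # ns) xs" if "xs \<in> set M" for xs
    using that L U(1) unfolding M(2) orthonormal_terms_def by (auto simp: mode_vectors_Cons)
  moreover have "vouter (m # ns) xs \<bullet> vouter (m # ns) ys = (if xs = ys then 1 else 0)"
    if in_M: "xs \<in> set M" "ys \<in> set M" for xs ys
  proof -
    obtain i xs' where i: "xs = col U i # xs'" "i < m" "xs' \<in> set (L i)" using in_M(1) M(2) by auto
    obtain j ys' where j: "ys = col U j # ys'" "j < m" "ys' \<in> set (L j)" using in_M(2) M(2) by auto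
    have "vouter (m # ns) xs \<bullet> vouter (m # ns) ys = (col U i \<bullet> col U j) * (vouter ns xs' \<bullet> vouter ns ys')"
      unfolding i j using U(1) by (intro vouter_inner_Cons) auto
    also have "\<dots> = (if xs = ys then 1 else 0)"
    proof (cases "i = j")
      case True
      then have "vouter ns xs' \<bullet> vouter ns ys' = (if xs' = ys' then 1 else 0)"
        using L[OF i(2)] i(3) j(3) by (simp add: orthonormal_terms_def)
      then show ?thesis using True i(1) j(1) gram_one_cols[OF U i(2) j(2)] by simp
    next
      case False
      then show ?thesis
        using i(1) j(1) gram_one_cols[OF U i(2) j(2)] orthonormal_cols_inj[OF U i(2) j(2)] by simp
    qed
    finally show ?thesis .
  qed
  ultimately show ?thesis using M(1) len by (simp add: orthonormal_terms_def)
qed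

text \<open>The bottom of the recursion is the number 1 as the only outer product of no vectors.\<close>

lemma orthonormal_terms_cols:
  assumes V: "V \<in> carrier_mat n n" "transpose_mat V * V = 1\<^sub>m n"
  shows "orthonormal_terms [n] (map (\<lambda>k. [col V k]) [0..<n])"
proof -
  have unit: "orthonormal_terms [] [[]]"
    by (simp add: orthonormal_terms_def mode_vectors_Nil vectorize_def outer_def scalar_prod_def)
  show ?thesis
    by (rule orthonormal_terms_level[OF V unit])
      (use orthonormal_cols_inj[OF V] in \<open>auto simp: distinct_map inj_on_def\<close>)
qed

text \<open>Above the last level, each left singular vector i is joined to all terms of one decomposition, the
  weighted and the zero-weight ones. The split of these terms into the three lists of the decomposition only permutes them.\<close>

lemma full_TTr1_orthonormal_terms:
  "full_TTr1 ns a ts zs \<Longrightarrow> orthonormal_terms ns (map snd ts @ zs)"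
proof (induction rule: full_TTr1.induct)
  case (last_level m n a U S V)
  then have U: "U \<in> carrier_mat m m" "transpose_mat U * U = 1\<^sub>m m"
    and V: "V \<in> carrier_mat n n" "transpose_mat V * V = 1\<^sub>m n"
    by (auto simp: full_svd_def is_svd_def Let_def reshape_def)
  show ?case
  proof (rule orthonormal_terms_level[OF U orthonormal_terms_cols[OF V]], goal_cases)
    case 1
    let ?D = "map (\<lambda>j. [col U j, col V j]) [0..<min m n]"
    let ?E = "[[col U j, col V k]. j \<leftarrow> [0..<m], k \<leftarrow> [0..<n], j \<noteq> k]"
    note inj = orthonormal_cols_inj[OF U] orthonormal_cols_inj[OF V]
    have "distinct ?D" using inj by (auto simp: distinct_map inj_on_def)
    moreover have "distinct ?E"
      by (intro distinct_concat_map) (auto simp: inj split: if_splits)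
    moreover have "set ?D \<inter> set ?E = {}" by (auto simp: inj split: if_splits)
    ultimately show ?case by (simp add: comp_def)
  next
    case 2
    let ?D = "map (\<lambda>j. [col U j, col V j]) [0..<min m n]"
    let ?E = "[[col U j, col V k]. j \<leftarrow> [0..<m], k \<leftarrow> [0..<n], j \<noteq> k]"
    have "set (?D @ ?E) = {[col U j, col V k] | j k. j < m \<and> k < n}"
      unfolding set_append by (rule set_diagonal_union_off_diagonal)
    then show ?case by (auto simp: comp_def)
  qed
next
  case (level ns m a U S V c ts zs)
  let ?K = "prod_list ns"
  let ?L = "\<lambda>i. map snd (ts i) @ zs i"
  have U: "U \<in> carrier_mat m m" "transpose_mat U * U = 1\<^sub>m m"
    using level(2,3) by (auto simp: is_svd_def Let_def reshape_def)
  have L: "orthonormal_terms ns (?L i)" if "i < m" for i using level(5) that by blast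
  then have dL: "distinct (?L i)" if "i < m" for i using that by (simp add: orthonormal_terms_def)
  define A where "A = (\<lambda>i. map ((#) (col U i)) (map snd (ts i)))"
  define B where "B = (\<lambda>i. map ((#) (col U i)) (zs i))"
  define M where "M = concat (map A [0..<min m ?K]) @ concat (map B [0..<m]) @ concat (map A [?K..<m])"
  have "map snd [(S $$ (i, i) * w, col U i # xs). i \<leftarrow> [0..<min m ?K], (w, xs) \<leftarrow> ts i] @
      ([col U i # xs. i \<leftarrow> [0..<m], xs \<leftarrow> zs i] @
        [col U i # xs. i \<leftarrow> [?K..<m], (w, xs) \<leftarrow> ts i]) = M"
    by (simp add: M_def A_def B_def map_concat comp_def case_prod_unfold)
  moreover have "orthonormal_terms (m # ns) M"
  proof (rule orthonormal_terms_level[OF U L])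
    have dA: "distinct (A i)" "distinct (B i)" "set (A i) \<inter> set (B i) = {}" if "i < m" for i
      using dL[OF that] by (auto simp: A_def B_def distinct_map inj_on_def)
    have dis: "set (A i) \<inter> set (A j) = {}" "set (A i) \<inter> set (B j) = {}" "set (B i) \<inter> set (B j) = {}"
      if "i < m" "j < m" "i \<noteq> j" for i j
      using orthonormal_cols_inj[OF U that(1,2)] that(3) by (auto simp: A_def B_def)
    have AB: "set (A i) \<inter> set (B j) = {}" if "i < m" "j < m" for i j
      using dA(3)[OF that(1)] dis(2)[OF that] by (cases "i = j") auto
    have "distinct (concat (map A [0..<min m ?K]))" "distinct (concat (map B [0..<m]))"
        "distinct (concat (map A [?K..<m]))"
      by (rule distinct_concat_map; use dA dis in simp)+
    moreover have "set (concat (map A [0..<min m ?K])) \<inter> set (concat (map B [0..<m])) = {}"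
      using AB by fastforce
    moreover have "set (concat (map A [?K..<m])) \<inter> set (concat (map B [0..<m])) = {}"
      using AB by fastforce
    moreover have "set (concat (map A [0..<min m ?K])) \<inter> set (concat (map A [?K..<m])) = {}"
      using dis(1) by fastforce
    ultimately show "distinct M" unfolding M_def by auto
    have "set M = (\<Union>i\<in>{0..<min m ?K} \<union> {?K..<m}. set (A i)) \<union> (\<Union>i<m. set (B i))"
      unfolding M_def by auto
    also have "{0..<min m ?K} \<union> {?K..<m} = {..<m}" by auto
    finally show "set M = {col U i # xs | i xs. i < m \<and> xs \<in> set (?L i)}"
      by (auto simp: A_def B_def)
  qed
  ultimately show ?case by simp
qed

text \<open>Insert the expansions of the right singular vectors into the singular value decomposition. Only the
  first min m K singular vectors carry a singular value, and each of these is joined to its own right singular vector.\<close>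

lemma full_TTr1_expansion:
  assumes "full_TTr1 ns a ts zs" "p < prod_list ns"
  shows "a $ p = (\<Sum>(w, xs)\<leftarrow>ts. w * vouter ns xs $ p)"
  using assms
proof (induction arbitrary: p rule: full_TTr1.induct)
  case (last_level m n a U S V)
  let ?i = "p mod m" and ?j = "p div m"
  have "p < m * n" using last_level(2) by simp
  then have ij: "?i < m" "?j < n" and p: "p = ?i + m * ?j" by (rule mixed_radix_div_less)+
  have U: "U \<in> carrier_mat m m" and S: "S \<in> carrier_mat m n" "diagonal_mat S"
    and V: "V \<in> carrier_mat n n" and M: "reshape m n a = U * S * transpose_mat V"
    using last_level(1) by (auto simp: full_svd_def is_svd_def Let_def reshape_def)
  have vo: "vouter [m, n] [col U l, col V l] $ p = U $$ (?i, l) * V $$ (?j, l)" if "l < min m n" for l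
  proof -
    have "vouter [n] [col V l] $ (?j + n * 0) = col V l $ ?j * vouter [] [] $ 0"
      using ij by (intro vouter_Cons_index) auto
    then have "vouter [n] [col V l] $ ?j = V $$ (?j, l)"
      using ij V that by (simp add: vectorize_def outer_def)
    moreover have "vouter [m, n] [col U l, col V l] $ (?i + m * ?j) = col U l $ ?i * vouter [n] [col V l] $ ?j"
      using ij by (intro vouter_Cons_index) auto
    ultimately show ?thesis using p ij U that by simp
  qed
  have "a $ p = reshape m n a $$ (?i, ?j)" using ij p by (simp add: reshape_def)
  also have "\<dots> = (\<Sum>l<min m n. S $$ (l, l) * U $$ (?i, l) * V $$ (?j, l))"
    unfolding M by (rule diagonal_factorization_index[OF U S V ij])
  also have "\<dots> = (\<Sum>l<min m n. S $$ (l, l) * vouter [m, n] [col U l, col V l] $ p)"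
    by (rule sum.cong) (simp_all add: vo)
  finally show ?case
    by (simp add: comp_def interv_sum_list_conv_sum_set_nat atLeast0LessThan)
next
  case (level ns m a U S V c ts zs)
  let ?K = "prod_list ns"
  define q where "q = dim_col V"
  let ?i = "p mod m" and ?j = "p div m"
  have "p < m * ?K" using level(6) by simp
  then have ij: "?i < m" "?j < ?K" and p: "p = ?i + m * ?j" by (rule mixed_radix_div_less)+
  have U: "U \<in> carrier_mat m m" and S: "S \<in> carrier_mat m q" "diagonal_mat S"
    and V: "V \<in> carrier_mat ?K q" and M: "reshape m ?K a = U * S * transpose_mat V"
    and qmin: "min m ?K \<le> q" and orthV: "transpose_mat V * V = 1\<^sub>m q"
    using level(2,3) by (auto simp: q_def is_svd_def Let_def reshape_def)
  \<comment> \<open>orthonormal columns bound the number of columns of V, so exactly min m K singular values occur\<close>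
  have "orthonormal ?K (cols V)"
    unfolding orthonormal_def
  proof (intro conjI allI impI)
    show "set (cols V) \<subseteq> carrier_vec ?K" using cols_dim[of V] V by simp
    fix i j assume "i < length (cols V)" "j < length (cols V)"
    then show "cols V ! i \<bullet> cols V ! j = (if i = j then 1 else 0)"
      using gram_one_cols[OF V orthV, of i j] by (simp add: q_def)
  qed
  then have "q \<le> ?K" using orthonormal_length by (metis cols_length q_def)
  then have min: "min m q = min m ?K" using qmin by auto
  have Vl: "V $$ (?j, l) = (\<Sum>(w, xs)\<leftarrow>ts l. w * vouter ns xs $ ?j)" if "l < min m ?K" for l
  proof -
    have "c l = l" using level(4) that by auto
    moreover have "\<forall>i<m. \<forall>p. p < ?K \<longrightarrow> col V (c i) $ p = (\<Sum>(w, xs)\<leftarrow>ts i. w * vouter ns xs $ p)"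
      using level(5) by blast
    ultimately have "col V l $ ?j = (\<Sum>(w, xs)\<leftarrow>ts l. w * vouter ns xs $ ?j)"
      using that ij by (metis min_less_iff_conj)
    then show ?thesis using V ij qmin that by simp
  qed
  have "a $ p = reshape m ?K a $$ (?i, ?j)" using ij p by (simp add: reshape_def)
  also have "\<dots> = (\<Sum>l<min m ?K. S $$ (l, l) * U $$ (?i, l) * V $$ (?j, l))"
    unfolding M diagonal_factorization_index[OF U S V ij] min ..
  also have "\<dots> = (\<Sum>l<min m ?K. \<Sum>(w, xs)\<leftarrow>ts l. S $$ (l, l) * w * vouter (m # ns) (col U l # xs) $ p)"
  proof (rule sum.cong)
    fix l assume "l \<in> {..<min m ?K}"
    then have l: "l < min m ?K" by simp
    have "vouter (m # ns) (col U l # xs) $ p = U $$ (?i, l) * vouter ns xs $ ?j" for xs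
      using vouter_Cons_index[OF ij, of "col U l" xs] p U ij l by simp
    then have "(\<Sum>(w, xs)\<leftarrow>ts l. S $$ (l, l) * w * vouter (m # ns) (col U l # xs) $ p)
        = (\<Sum>(w, xs)\<leftarrow>ts l. S $$ (l, l) * U $$ (?i, l) * (w * vouter ns xs $ ?j))"
      by (simp add: mult_ac)
    then show "S $$ (l, l) * U $$ (?i, l) * V $$ (?j, l)
        = (\<Sum>(w, xs)\<leftarrow>ts l. S $$ (l, l) * w * vouter (m # ns) (col U l # xs) $ p)"
      unfolding Vl[OF l] by (simp add: case_prod_unfold sum_list_const_mult)
  qed simp
  finally show ?case
    by (simp add: sum_list_concat_map_upt case_prod_unfold comp_def)
qed

section \<open>Completing the zero-weight terms to a basis\<close>

text \<open>The rank is the dimension of the span of the set of columns. Repeated columns would make it smaller than the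
  number of columns, so they are excluded before independence is read off.\<close>

lemma full_column_rank_kernel:
  fixes P :: "real mat"
  assumes P: "P \<in> carrier_mat n nc" and rank: "vec_space.rank n P = nc"
    and c: "c \<in> carrier_vec nc" "P *\<^sub>v c = 0\<^sub>v n"
  shows "c = 0\<^sub>v nc"
proof (rule ccontr)
  assume c0: "c \<noteq> 0\<^sub>v nc"
  interpret vec_space "TYPE(real)" n .
  obtain S where S: "finite S" "maximal S (\<lambda>T. T \<subseteq> set (cols P) \<and> lin_indpt T)"
  proof -
    have "lin_indpt {}" by (simp add: lin_dep_def)
    then show thesis
      using maximal_exists_superset[of "set (cols P)" "\<lambda>T. T \<subseteq> set (cols P) \<and> lin_indpt T" "{}"] that
      by auto
  qed
  then have "nc = card S" using rank_card_indpt[OF P S(2)] rank by simp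
  also have "\<dots> \<le> card (set (cols P))"
    using S(2) by (intro card_mono) (auto simp: maximal_def)
  finally have "length (cols P) \<le> card (set (cols P))" using P by simp
  then have "distinct (cols P)" by (metis card_distinct card_length le_antisym)
  then show False
    using lin_depI[OF P c(1) c0 c(2)] full_rank_lin_indpt[OF P rank] by blast
qed

text \<open>The columns of P complete the normalized vector s to an orthonormal basis.\<close>

lemma perp_matrix_exists:
  assumes "s \<noteq> 0\<^sub>v (dim_vec s)"
  shows "\<exists>P. perp_matrix s P \<and> orthogonal_mat P"
proof -
  define r where "r = dim_vec s"
  interpret vec_space "TYPE(real)" r .
  have s: "s \<in> carrier_vec r" "s \<noteq> 0\<^sub>v r" using assms by (auto simp: r_def)
  define s' where "s' = (1 / sqrt (s \<bullet> s)) \<cdot>\<^sub>v s"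
  have "orthonormal r ([] @ [s'])"
    unfolding s'_def by (rule orthonormal_snoc) (use s in \<open>auto simp: orthonormal_def\<close>)
  then have "orthonormal r [s']" by simp
  then obtain vs where vs: "orthonormal r ([s'] @ vs)" "length ([s'] @ vs) = r"
    by (rule orthonormal_extend)
  define P where "P = mat_of_cols r vs"
  have vsc: "set vs \<subseteq> carrier_vec r" using vs(1) by (auto simp: orthonormal_def)
  have len: "length vs = r - 1" using vs(2) by simp
  have P: "P \<in> carrier_mat r (r - 1)" using mat_of_cols_carrier(1)[of r vs] len by (simp add: P_def)
  have ovs: "orthonormal r vs" using vs(1) unfolding orthonormal_iff_set by auto
  have ss: "sqrt (s \<bullet> s) \<noteq> 0" using s conjugate_square_greater_0_vec[OF s(1)] by simp
  have vs_perp: "v \<bullet> s = 0" if "v \<in> set vs" for v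
  proof -
    have "v \<bullet> s' = 0" using vs(1) that unfolding orthonormal_iff_set by auto
    moreover have "v \<in> carrier_vec r" using vsc that by auto
    ultimately show ?thesis using ss s(1) by (simp add: s'_def)
  qed
  have "transpose_mat P *\<^sub>v s = 0\<^sub>v (r - 1)"
    by (rule eq_vecI) (use vs_perp vsc len in \<open>auto simp: P_def subset_iff\<close>)
  moreover have "rank P = r - 1"
  proof (rule lin_indpt_full_rank[OF P])
    have cols: "cols P = vs" using vsc by (simp add: P_def)
    show d: "distinct (cols P)" using ovs unfolding cols orthonormal_iff_set by blast
    have gram: "transpose_mat P * P = 1\<^sub>m (r - 1)" using orthonormal_gram[OF ovs] len by (simp add: P_def)
    show "lin_indpt (set (cols P))"
    proof
      assume ld: "lin_dep (set (cols P))"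
      obtain c where "c \<in> carrier_vec (r - 1)" "c \<noteq> 0\<^sub>v (r - 1)" "P *\<^sub>v c = 0\<^sub>v r"
        by (rule lin_depE[OF P ld d])
      with gram_one_kernel[OF P gram] show False by blast
    qed
  qed
  ultimately have "perp_matrix s P" using P by (simp add: perp_matrix_def r_def)
  moreover have "orthogonal_mat P"
    by (rule orthogonal_matI) (use ovs vsc in \<open>auto simp: P_def orthonormal_def subset_iff\<close>)
  ultimately show ?thesis by blast
qed

text \<open>What the basis of the hyperplane uses of a decomposition: T and Z form an orthonormal basis, and a is a
  combination of T alone, with coefficient vector s. In the application T and Z are the vectorized terms of the
  economical decomposition and the additional terms of weight zero.\<close>

locale orthonormal_frame =
  fixes N :: nat and T Z :: "real vec list" and s a :: "real vec"
  assumes frame: "orthonormal N (T @ Z)" "length (T @ Z) = N"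
    and s: "s \<in> carrier_vec (length T)"
    and a_eq: "a = mat_of_cols N (T @ Z) *\<^sub>v (s @\<^sub>v 0\<^sub>v (length Z))"
    and a_nonzero: "a \<noteq> 0\<^sub>v N"
begin

abbreviation "F \<equiv> mat_of_cols N (T @ Z)"
abbreviation "M \<equiv> mat_of_cols N T"

lemma F_carrier: "F \<in> carrier_mat N N"
  using mat_of_cols_carrier(1)[of N "T @ Z"] frame(2) by simp

lemma M_carrier: "M \<in> carrier_mat N (length T)"
  by simp

lemma F_gram: "transpose_mat F * F = 1\<^sub>m N"
  using orthonormal_gram[OF frame(1)] frame(2) by simp

lemma carriers: "set T \<subseteq> carrier_vec N" "set Z \<subseteq> carrier_vec N"
  using frame(1) by (auto simp: orthonormal_def)

lemma M_gram: "transpose_mat M * M = 1\<^sub>m (length T)"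
  using frame(1) by (intro orthonormal_gram) (auto simp: orthonormal_iff_set)

lemma coeff_carrier: "s @\<^sub>v 0\<^sub>v (length Z) \<in> carrier_vec N"
  using append_carrier_vec[OF s zero_carrier_vec[of "length Z"]] frame(2) by simp

lemma a_carrier: "a \<in> carrier_vec N"
  unfolding a_eq by (rule mult_mat_vec_carrier[OF F_carrier coeff_carrier])

lemma frame_coeff:
  assumes "i < N"
  shows "(T @ Z) ! i \<bullet> a = (s @\<^sub>v 0\<^sub>v (length Z)) $ i"
proof -
  have "transpose_mat F *\<^sub>v a = s @\<^sub>v 0\<^sub>v (length Z)"
    unfolding a_eq by (rule gram_one_cancel[OF F_carrier F_gram coeff_carrier])
  moreover have "(transpose_mat F *\<^sub>v a) $ i = (T @ Z) ! i \<bullet> a"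
  proof -
    have "(T @ Z) ! i \<in> set (T @ Z)" using assms frame(2) by (intro nth_mem) simp
    then have "(T @ Z) ! i \<in> carrier_vec N" using frame(1) unfolding orthonormal_def by blast
    then show ?thesis using assms frame(2) by simp
  qed
  ultimately show ?thesis by simp
qed

lemma Z_perp: "z \<in> set Z \<Longrightarrow> z \<bullet> a = 0"
proof -
  assume "z \<in> set Z"
  then obtain i where "i < length Z" "z = Z ! i" by (metis in_set_conv_nth)
  then show "z \<bullet> a = 0"
    using frame_coeff[of "length T + i"] frame(2) s by (simp add: nth_append)
qed

lemma M_transpose_a: "transpose_mat M *\<^sub>v a = s"
proof (rule eq_vecI)
  fix i assume "i < dim_vec s"
  then have i: "i < length T" using s by simp
  then have "T ! i \<in> carrier_vec N" using carriers(1) by (simp add: subset_iff)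
  then show "(transpose_mat M *\<^sub>v a) $ i = s $ i"
    using frame_coeff[of i] frame(2) s i by (simp add: nth_append)
qed (use s in simp)

lemma M_inner:
  assumes "x \<in> carrier_vec (length T)" "y \<in> carrier_vec (length T)"
  shows "(M *\<^sub>v x) \<bullet> (M *\<^sub>v y) = x \<bullet> y"
proof -
  have "(M *\<^sub>v x) \<bullet> (M *\<^sub>v y) = (transpose_mat M *\<^sub>v (M *\<^sub>v x)) \<bullet> y"
    using transpose_vec_mult_scalar[OF M_carrier assms(2), of "M *\<^sub>v x"]
      mult_mat_vec_carrier[OF M_carrier assms(1)] by simp
  also have "transpose_mat M *\<^sub>v (M *\<^sub>v x) = x"
    by (rule gram_one_cancel[OF M_carrier M_gram assms(1)])
  finally show ?thesis .
qed

lemma Z_M_inner: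
  assumes z: "z \<in> set Z" and x: "x \<in> carrier_vec (length T)"
  shows "z \<bullet> (M *\<^sub>v x) = 0" "(M *\<^sub>v x) \<bullet> z = 0"
proof -
  have zc: "z \<in> carrier_vec N" using z carriers(2) by auto
  have "t \<bullet> z = 0" if "t \<in> set T" for t
    using frame(1) that z unfolding orthonormal_iff_set by auto
  then have "transpose_mat M *\<^sub>v z = 0\<^sub>v (length T)"
    by (intro eq_vecI) (use carriers(1) in \<open>auto simp: subset_iff\<close>)
  then show "z \<bullet> (M *\<^sub>v x) = 0"
    using transpose_vec_mult_scalar[OF M_carrier x zc] x by simp
  then show "(M *\<^sub>v x) \<bullet> z = 0"
    using comm_scalar_prod[OF zc mult_mat_vec_carrier[OF M_carrier x]] by simp
qed

lemma s_nonzero: "s \<noteq> 0\<^sub>v (dim_vec s)"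
proof
  assume "s = 0\<^sub>v (dim_vec s)"
  then have s0: "s = 0\<^sub>v (length T)" using s by simp
  have "0\<^sub>v (length T) @\<^sub>v 0\<^sub>v (length Z) = (0\<^sub>v N :: real vec)"
    by (intro eq_vecI) (use frame(2) in auto)
  then have "a = F *\<^sub>v 0\<^sub>v N" using a_eq unfolding s0 by simp
  also have "\<dots> = 0\<^sub>v N" using F_carrier by (intro eq_vecI) auto
  finally show False using a_nonzero by simp
qed

lemma T_nonempty: "T \<noteq> []"
  using s_nonzero s by auto

context
  fixes P
  assumes P: "perp_matrix s P"
begin

lemma P_carrier: "P \<in> carrier_mat (length T) (length T - 1)"
  using P s by (simp add: perp_matrix_def)

lemma col_P_carrier: "col P j \<in> carrier_vec (length T)"
  using col_dim[of P j] carrier_matD(1)[OF P_carrier] by simp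

lemma cols_MP: "cols (M * P) = map (\<lambda>j. M *\<^sub>v col P j) [0..<length T - 1]"
  using P_carrier by (auto simp: cols_def intro!: eq_vecI)

lemma length_basis: "length (Z @ cols (M * P)) = N - 1"
  using frame(2) T_nonempty carrier_matD(2)[OF P_carrier] by (cases T) simp_all

lemma col_MP_perp: "b \<in> set (cols (M * P)) \<Longrightarrow> b \<bullet> a = 0"
proof -
  assume "b \<in> set (cols (M * P))"
  then obtain j where j: "j < length T - 1" "b = M *\<^sub>v col P j" by (auto simp: cols_MP)
  note c = col_P_carrier[of j]
  have "b \<bullet> a = a \<bullet> b"
    using j(2) comm_scalar_prod[OF a_carrier mult_mat_vec_carrier[OF M_carrier c]] by simp
  also have "\<dots> = s \<bullet> col P j"
    unfolding j(2) using transpose_vec_mult_scalar[OF M_carrier c a_carrier] by (simp add: M_transpose_a)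
  also have "\<dots> = (transpose_mat P *\<^sub>v s) $ j"
    using j(1) P_carrier comm_scalar_prod[OF s c] by simp
  also have "\<dots> = 0" using P j(1) s by (simp add: perp_matrix_def)
  finally show "b \<bullet> a = 0" .
qed

text \<open>A vanishing combination of Z and of the columns of M P is an expansion in the basis T, Z with coefficients
  P y and x. So x = 0 and P y = 0, and P has full column rank.\<close>

lemma indep_basis: "indep_list N (Z @ cols (M * P))"
  unfolding indep_list_def
proof (intro conjI ballI impI)
  have "set (cols (M * P)) \<subseteq> carrier_vec N"
    using mult_mat_vec_carrier[OF M_carrier col_P_carrier] by (auto simp: cols_MP)
  then show "set (Z @ cols (M * P)) \<subseteq> carrier_vec N" using carriers(2) by simp
  fix c :: "real vec"
  assume c: "c \<in> carrier_vec (length (Z @ cols (M * P)))" "mat_of_cols N (Z @ cols (M * P)) *\<^sub>v c = 0\<^sub>v N"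
  let ?l = "length T - 1"
  define x where "x = vec_first c (length Z)"
  define y where "y = vec_last c ?l"
  have x: "x \<in> carrier_vec (length Z)" and y: "y \<in> carrier_vec ?l" by (simp_all add: x_def y_def)
  have "c \<in> carrier_vec (length Z + ?l)" using c(1) by (simp add: cols_MP)
  then have cxy: "c = x @\<^sub>v y" by (simp add: x_def y_def)
  have Py: "P *\<^sub>v y \<in> carrier_vec (length T)" using mult_mat_vec_carrier[OF P_carrier y] .
  have y': "y \<in> carrier_vec (length (cols (M * P)))" using y by (simp add: cols_MP)
  have MP: "mat_of_cols N (cols (M * P)) = M * P"
    using mat_of_cols_cols[of "M * P"] by simp
  have "0\<^sub>v N = mat_of_cols N Z *\<^sub>v x + (M * P) *\<^sub>v y"
    using c(2) mat_of_cols_append_mult[OF x y', of N] unfolding cxy MP by simp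
  also have "(M * P) *\<^sub>v y = M *\<^sub>v (P *\<^sub>v y)" using assoc_mult_mat_vec[OF M_carrier P_carrier y] .
  also have "mat_of_cols N Z *\<^sub>v x + M *\<^sub>v (P *\<^sub>v y) = M *\<^sub>v (P *\<^sub>v y) + mat_of_cols N Z *\<^sub>v x"
    by (rule comm_add_vec)
      (rule mult_mat_vec_carrier[OF mat_of_cols_carrier(1) x] mult_mat_vec_carrier[OF M_carrier Py])+
  also have "\<dots> = F *\<^sub>v ((P *\<^sub>v y) @\<^sub>v x)"
    using mat_of_cols_append_mult[OF Py x] by simp
  finally have "F *\<^sub>v ((P *\<^sub>v y) @\<^sub>v x) = 0\<^sub>v N" by simp
  moreover have "(P *\<^sub>v y) @\<^sub>v x \<in> carrier_vec N"
    using append_carrier_vec[OF Py x] frame(2) by simp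
  ultimately have 0: "(P *\<^sub>v y) @\<^sub>v x = 0\<^sub>v N"
    using gram_one_kernel[OF F_carrier F_gram] by blast
  have nth0: "((P *\<^sub>v y) @\<^sub>v x) $ i = 0" if "i < N" for i unfolding 0 using that by simp
  have "P *\<^sub>v y = 0\<^sub>v (length T)"
  proof (rule eq_vecI)
    fix i assume "i < dim_vec (0\<^sub>v (length T) :: real vec)"
    then show "(P *\<^sub>v y) $ i = 0\<^sub>v (length T) $ i"
      using nth0[of i] Py frame(2) x by (simp add: carrier_matD(1)[OF P_carrier])
  qed (use carrier_matD(1)[OF P_carrier] in simp)
  then have y0: "y = 0\<^sub>v ?l"
    using full_column_rank_kernel[OF P_carrier _ y] P s by (simp add: perp_matrix_def)
  have x0: "x = 0\<^sub>v (length Z)"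
  proof (rule eq_vecI)
    fix i assume "i < dim_vec (0\<^sub>v (length Z) :: real vec)"
    then show "x $ i = 0\<^sub>v (length Z) $ i"
      using nth0[of "length T + i"] frame(2) x by (simp add: carrier_matD(1)[OF P_carrier])
  qed (use x in auto)
  show "c = 0\<^sub>v (length (Z @ cols (M * P)))"
    unfolding cxy x0 y0 by (intro eq_vecI) (auto simp: cols_MP)
qed

lemma basis_of_perp: "basis_of N {v \<in> carrier_vec N. v \<bullet> a = 0} (Z @ cols (M * P))"
  by (rule basis_of_hyperplane(1)[OF a_carrier a_nonzero indep_basis length_basis])
    (use Z_perp col_MP_perp in auto)

lemma orthogonal_basis:
  assumes "orthogonal_mat P"
  shows "orthogonal (Z @ cols (M * P))"
  unfolding orthogonal_def
proof (intro allI impI)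
  let ?l = "length T - 1"
  note c = col_P_carrier
  have zz: "(Z ! i \<bullet> Z ! j = 0) = (i \<noteq> j)" if "i < length Z" "j < length Z" for i j
  proof -
    have "orthonormal N Z" using frame(1) by (auto simp: orthonormal_iff_set)
    then show ?thesis using that by (simp add: orthonormal_def)
  qed
  have pp: "((M *\<^sub>v col P i) \<bullet> (M *\<^sub>v col P j) = 0) = (i \<noteq> j)" if "i < ?l" "j < ?l" for i j
    using M_inner[OF c c] orthogonal_matD[OF assms, of i j] that P_carrier by simp
  fix i j assume "i < length (Z @ cols (M * P))" "j < length (Z @ cols (M * P))"
  then show "((Z @ cols (M * P)) ! i \<bullet> (Z @ cols (M * P)) ! j = 0) = (i \<noteq> j)"
    using zz pp Z_M_inner[OF nth_mem c] by (auto simp: nth_append cols_MP)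
qed

end

end

section \<open>Assembling the theorem\<close>

lemma full_TTr1_frame:
  assumes a: "vectorize ns A \<noteq> 0\<^sub>v (prod_list ns)"
    and TT: "full_TTr1 ns (vectorize ns A) ts zs"
  defines "T \<equiv> map (\<lambda>(w, xs). vouter ns xs) ts" and "Z \<equiv> map (\<lambda>xs. vouter ns xs) zs"
    and "s \<equiv> vec_of_list (map fst ts)"
  shows "orthonormal_frame (prod_list ns) T Z s (vectorize ns A)"
proof
  let ?N = "prod_list ns"
  define L where "L = map snd ts @ zs"
  have terms: "orthonormal_terms ns L" unfolding L_def by (rule full_TTr1_orthonormal_terms[OF TT])
  have TZ: "T @ Z = map (vouter ns) L"
    by (simp add: T_def Z_def L_def case_prod_unfold)
  show "orthonormal ?N (T @ Z)"
    unfolding TZ orthonormal_def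
  proof (intro conjI allI impI)
    fix i j assume "i < length (map (vouter ns) L)" "j < length (map (vouter ns) L)"
    then have ij: "i < length L" "j < length L" by simp_all
    then have "L ! i = L ! j \<longleftrightarrow> i = j"
      using terms by (simp add: orthonormal_terms_def nth_eq_iff_index_eq)
    then show "map (vouter ns) L ! i \<bullet> map (vouter ns) L ! j = (if i = j then 1 else 0)"
      using terms ij unfolding orthonormal_terms_def by simp
  qed auto
  show "length (T @ Z) = ?N" using terms unfolding TZ orthonormal_terms_def by simp
  show s: "s \<in> carrier_vec (length T)" by (rule carrier_vecI) (simp add: s_def T_def)
  show "vectorize ns A = mat_of_cols ?N (T @ Z) *\<^sub>v (s @\<^sub>v 0\<^sub>v (length Z))"
  proof (rule eq_vecI)
    fix p assume "p < dim_vec (mat_of_cols ?N (T @ Z) *\<^sub>v (s @\<^sub>v 0\<^sub>v (length Z)))"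
    then have p: "p < ?N" by simp
    have "vectorize ns A $ p = (\<Sum>(w, xs)\<leftarrow>ts. w * vouter ns xs $ p)"
      by (rule full_TTr1_expansion[OF TT p])
    also have "\<dots> = (\<Sum>l<length T. T ! l $ p * s $ l)"
      by (simp add: sum_list_sum_nth T_def s_def case_prod_unfold atLeast0LessThan mult.commute vec_of_list_index)
    also have "\<dots> = (mat_of_cols ?N T *\<^sub>v s) $ p"
      using p s by (simp add: scalar_prod_def mat_of_cols_index atLeast0LessThan)
    also have "\<dots> = (mat_of_cols ?N (T @ Z) *\<^sub>v (s @\<^sub>v 0\<^sub>v (length Z))) $ p"
      using p by (subst mat_of_cols_append_mult[OF s]) (auto simp: scalar_prod_def)
    finally show "vectorize ns A $ p = (mat_of_cols ?N (T @ Z) *\<^sub>v (s @\<^sub>v 0\<^sub>v (length Z))) $ p" .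
  qed simp
qed (rule a)

lemma full_TTr1_basis:
  assumes a: "vectorize ns A \<noteq> 0\<^sub>v (prod_list ns)"
    and TT: "full_TTr1 ns (vectorize ns A) ts zs"
  shows "let N = prod_list ns; W = opspan_perp ns A;
               T = map (\<lambda>(w, xs). vectorize ns (outer xs)) ts;
               Z = map (\<lambda>xs. vectorize ns (outer xs)) zs;
               s = vec_of_list (map fst ts) in
           (\<forall>xs \<in> set (map snd ts @ zs). mode_vectors ns xs) \<and>
           length (T @ Z) = N \<and>
           transpose_mat (mat_of_cols N (T @ Z)) * mat_of_cols N (T @ Z) = 1\<^sub>m N \<and>
           vectorize ns A = mat_of_cols N (T @ Z) *\<^sub>v (s @\<^sub>v 0\<^sub>v (length Z)) \<and>
           (\<forall>z\<in>set Z. z \<bullet> vectorize ns A = 0) \<and>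
           (\<exists>P. perp_matrix s P \<and> orthogonal_mat P) \<and>
           (\<forall>P. perp_matrix s P \<longrightarrow>
              basis_of N W (Z @ cols (mat_of_cols N T * P)) \<and>
              (orthogonal_mat P \<longrightarrow> orthogonal (Z @ cols (mat_of_cols N T * P))))"
proof -
  interpret orthonormal_frame "prod_list ns" "map (\<lambda>(w, xs). vouter ns xs) ts"
      "map (\<lambda>xs. vouter ns xs) zs" "vec_of_list (map fst ts)" "vectorize ns A"
    by (rule full_TTr1_frame[OF a TT])
  have "\<forall>xs \<in> set (map snd ts @ zs). mode_vectors ns xs"
    using full_TTr1_orthonormal_terms[OF TT] unfolding orthonormal_terms_def by blast
  then show ?thesis
    unfolding Let_def opspan_perp_eq_hyperplane[OF a]
    using frame(2) F_gram a_eq Z_perp perp_matrix_exists[OF s_nonzero] basis_of_perp orthogonal_basis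
    by blast
qed

lemma opspan_perp_orthogonal_complement:
  assumes a: "vectorize ns A \<noteq> 0\<^sub>v (prod_list ns)"
  shows "let N = prod_list ns; W = opspan_perp ns A in
       subspace class_ring W (module_vec TYPE(real) N) \<and>
       vectorspace.dim class_ring ((module_vec TYPE(real) N)\<lparr>carrier := W\<rparr>) = N - 1 \<and>
       (\<exists>bs. basis_of N W bs \<and> length bs = N - 1 \<and>
          (\<forall>b\<in>set bs. \<exists>xs. mode_vectors ns xs \<and> b = vectorize ns (outer xs))) \<and>
       (\<forall>B. vectorize ns B \<in> W \<longrightarrow> tensor_inner ns A B = 0) \<and>
       W = {v \<in> carrier_vec N. v \<bullet> vectorize ns A = 0}"
proof -
  let ?N = "prod_list ns" and ?a = "vectorize ns A"
  note W = opspan_perp_eq_hyperplane[OF a]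
  have comm: "v \<bullet> ?a = ?a \<bullet> v" if "v \<in> carrier_vec ?N" for v
    using comm_scalar_prod[OF that vectorize_carrier] .
  obtain bs where bs: "indep_list ?N bs" "length bs = ?N - 1"
    and rank1: "set bs \<subseteq> {vouter ns xs | xs. mode_vectors ns xs \<and> tensor_inner ns A (outer xs) = 0}"
    by (rule rank_one_hyperplane_basis[OF a])
  have ort: "b \<bullet> ?a = 0" if "b \<in> set bs" for b
    using that rank1 comm by (auto simp: tensor_inner_vectorize)
  note basis = basis_of_hyperplane[OF vectorize_carrier a bs ort]
  have "\<forall>b\<in>set bs. \<exists>xs. mode_vectors ns xs \<and> b = vouter ns xs" using rank1 by blast
  moreover have "tensor_inner ns A B = 0" if "vectorize ns B \<in> {v \<in> carrier_vec ?N. v \<bullet> ?a = 0}" for B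
    using that comm by (simp add: tensor_inner_vectorize)
  ultimately show ?thesis
    unfolding Let_def W using basis bs(2) by blast
qed

lemma example_svds_exist:
  "\<exists>U S V UU SS VV. economical_svd (reshape 3 8 a) U S V \<and>
         (\<forall>i<3. full_svd (reshape 4 2 (col V i)) (UU i) (SS i) (VV i))"
proof -
  obtain U S V where "economical_svd (reshape 3 8 a) U S V"
    by (rule economical_svd_exists[OF reshape_carrier[of 3 8 a]]) auto
  moreover have "\<forall>i. \<exists>U S V'. full_svd (reshape 4 2 (col V i)) U S V'"
  proof
    fix i
    obtain U S V' where "full_svd (reshape 4 2 (col V i)) U S V'"
      by (rule full_svd_exists[OF reshape_carrier])
    then show "\<exists>U S V'. full_svd (reshape 4 2 (col V i)) U S V'" by blast
  qed
  then obtain UU SS VV where "\<forall>i. full_svd (reshape 4 2 (col V i)) (UU i) (SS i) (VV i)" by metis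
  ultimately show ?thesis by blast
qed

lemma upt_small: "[0..<2] = [0, 1 :: nat]" "[0..<3] = [0, 1, 2 :: nat]" "[0..<4] = [0, 1, 2, 3 :: nat]"
  by (simp_all add: numeral_eq_Suc)

text \<open>Since 3 \<open>\<le>\<close> 8, each of the three left singular vectors has a right singular vector of its own, already in the
  economical decomposition, and no left singular vector has to borrow one.\<close>

lemma example_full_TTr1:
  fixes UU SS VV :: "nat \<Rightarrow> real mat"
  assumes eco: "economical_svd (reshape 3 8 a) U S V"
    and full: "\<forall>i<3. full_svd (reshape 4 2 (col V i)) (UU i) (SS i) (VV i)"
  defines "term \<equiv> (\<lambda>i j k. [col U i, col (UU i) j, col (VV i) k])"
  shows "full_TTr1 [3, 4, 2] a
    [(S $$ (i, i) * SS i $$ (j, j), term i j j). i \<leftarrow> [0..<3], j \<leftarrow> [0..<2]]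
    [term i j k. i \<leftarrow> [0..<3], j \<leftarrow> [0..<4], k \<leftarrow> [0..<2], j \<noteq> k]"
proof -
  define ts where "ts = (\<lambda>i. [(SS i $$ (j, j), [col (UU i) j, col (VV i) j]). j \<leftarrow> [0..<min 4 2]])"
  define zs where "zs = (\<lambda>i. [[col (UU i) j, col (VV i) k]. j \<leftarrow> [0..<4], k \<leftarrow> [0..<2], j \<noteq> k])"
  have svd: "is_svd (reshape 3 (prod_list [4, 2]) a) U S V" and dims: "dim_col U = 3" "dim_col V = 3"
    using eco by (simp_all add: economical_svd_def reshape_def)
  have "\<forall>i<3. full_TTr1 [4, 2] (col V (id i)) (ts i) (zs i)"
    unfolding ts_def zs_def id_apply using full by (intro allI impI full_TTr1.last_level) blast
  then have "full_TTr1 (3 # [4, 2]) a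
       [(S $$ (i, i) * w, col U i # xs). i \<leftarrow> [0..<min 3 (prod_list [4, 2])], (w, xs) \<leftarrow> ts i]
       ([col U i # xs. i \<leftarrow> [0..<3], xs \<leftarrow> zs i] @
        [col U i # xs. i \<leftarrow> [prod_list [4, 2]..<3], (w, xs) \<leftarrow> ts i])"
    by (intro full_TTr1.level[OF _ svd dims(1)]) (use dims in auto)
  moreover have "[(S $$ (i, i) * w, col U i # xs). i \<leftarrow> [0..<min 3 (prod_list [4, 2])], (w, xs) \<leftarrow> ts i]
      = [(S $$ (i, i) * SS i $$ (j, j), term i j j). i \<leftarrow> [0..<3], j \<leftarrow> [0..<2]]"
    by (simp add: ts_def term_def comp_def)
  moreover have "[col U i # xs. i \<leftarrow> [0..<3], xs \<leftarrow> zs i] @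
        [col U i # xs. i \<leftarrow> [prod_list [4, 2]..<3], (w, xs) \<leftarrow> ts i]
      = [term i j k. i \<leftarrow> [0..<3], j \<leftarrow> [0..<4], k \<leftarrow> [0..<2], j \<noteq> k]"
    by (simp add: zs_def term_def upt_small)
  ultimately show ?thesis by simp
qed

lemma example_tensor_nonzero: "vectorize [3, 4, 2] example_tensor \<noteq> 0\<^sub>v (prod_list [3, 4, 2])"
proof (rule vectorize_nonzero, rule bexI)
  show "example_tensor [0, 0, 0] \<noteq> 0" by (simp add: example_tensor_def)
  show "[0, 0, 0] \<in> tensor_indices [3, 4, 2]" by (simp add: tensor_indices_def)
qed

theorem mainTheorem3:
  shows
  "(\<forall>(ns :: nat list) (A :: tensor).
      ns \<noteq> [] \<and> (\<exists>is\<in>tensor_indices ns. A is \<noteq> 0) \<longrightarrow>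
      (let N = prod_list ns; W = opspan_perp ns A in
       subspace class_ring W (module_vec TYPE(real) N) \<and>
       vectorspace.dim class_ring ((module_vec TYPE(real) N)\<lparr>carrier := W\<rparr>) = N - 1 \<and>
       (\<exists>bs. basis_of N W bs \<and> length bs = N - 1 \<and>
          (\<forall>b\<in>set bs. \<exists>xs. mode_vectors ns xs \<and> b = vectorize ns (outer xs))) \<and>
       (\<forall>B. vectorize ns B \<in> W \<longrightarrow> tensor_inner ns A B = 0) \<and>
       W = {v \<in> carrier_vec N. v \<bullet> vectorize ns A = 0} \<and>
       (2 \<le> length ns \<longrightarrow>
        (\<exists>ts zs. full_TTr1 ns (vectorize ns A) ts zs) \<and>
        (\<forall>ts zs. full_TTr1 ns (vectorize ns A) ts zs \<longrightarrow>
          (let T = map (\<lambda>(w, xs). vectorize ns (outer xs)) ts;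
               Z = map (\<lambda>xs. vectorize ns (outer xs)) zs;
               s = vec_of_list (map fst ts) in
           (\<forall>xs \<in> set (map snd ts @ zs). mode_vectors ns xs) \<and>
           length (T @ Z) = N \<and>
           transpose_mat (mat_of_cols N (T @ Z)) * mat_of_cols N (T @ Z) = 1\<^sub>m N \<and>
           vectorize ns A = mat_of_cols N (T @ Z) *\<^sub>v (s @\<^sub>v 0\<^sub>v (length Z)) \<and>
           (\<forall>z\<in>set Z. z \<bullet> vectorize ns A = 0) \<and>
           (\<exists>P. perp_matrix s P \<and> orthogonal_mat P) \<and>
           (\<forall>P. perp_matrix s P \<longrightarrow>
              basis_of N W (Z @ cols (mat_of_cols N T * P)) \<and>
              (orthogonal_mat P \<longrightarrow> orthogonal (Z @ cols (mat_of_cols N T * P))))))))) \<and>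
   (let ns = [3, 4, 2]; A = example_tensor; a = vectorize ns A; W = opspan_perp ns A in
      (\<exists>U S V UU SS VV. economical_svd (reshape 3 8 a) U S V \<and>
         (\<forall>i<3. full_svd (reshape 4 2 (col V i)) (UU i) (SS i) (VV i))) \<and>
      (\<forall>U S V (UU :: nat \<Rightarrow> real mat) SS VV.
         economical_svd (reshape 3 8 a) U S V \<and>
         (\<forall>i<3. full_svd (reshape 4 2 (col V i)) (UU i) (SS i) (VV i)) \<longrightarrow>
         (let term = (\<lambda>i j k. [col U i, col (UU i) j, col (VV i) k]);
              ts = [(S $$ (i, i) * SS i $$ (j, j), term i j j). i \<leftarrow> [0..<3], j \<leftarrow> [0..<2]];
              zs = [term i j k. i \<leftarrow> [0..<3], j \<leftarrow> [0..<4], k \<leftarrow> [0..<2], j \<noteq> k];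
              T = map (\<lambda>(w, xs). vectorize ns (outer xs)) ts;
              Z = map (\<lambda>xs. vectorize ns (outer xs)) zs;
              s = vec_of_list (map fst ts) in
          full_TTr1 ns a ts zs \<and>
          length T = 6 \<and> length Z = 18 \<and>
          transpose_mat (mat_of_cols 24 (T @ Z)) * mat_of_cols 24 (T @ Z) = 1\<^sub>m 24 \<and>
          a = mat_of_cols 24 (T @ Z) *\<^sub>v (s @\<^sub>v 0\<^sub>v 18) \<and>
          (\<forall>z\<in>set Z. z \<bullet> a = 0) \<and>
          (\<exists>P. perp_matrix s P \<and> orthogonal_mat P) \<and>
          (\<forall>P. perp_matrix s P \<longrightarrow>
             P \<in> carrier_mat 6 5 \<and>
             basis_of 24 W (Z @ cols (mat_of_cols 24 T * P)) \<and>
             (orthogonal_mat P \<longrightarrow> orthogonal (Z @ cols (mat_of_cols 24 T * P)))))))"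
proof (rule conjI, goal_cases)
  case 1
  show ?case
  proof (intro allI impI, goal_cases)
    case (1 ns A)
    then have nz: "\<exists>is\<in>tensor_indices ns. A is \<noteq> 0" by blast
    note a = vectorize_nonzero[OF nz]
    have "0 \<notin> set ns"
    proof
      assume "0 \<in> set ns"
      then have "tensor_indices ns = {}"
        by (induction ns) (auto simp: tensor_indices_Cons)
      with nz show False by simp
    qed
    then have ex: "2 \<le> length ns \<Longrightarrow> \<exists>ts zs. full_TTr1 ns (vectorize ns A) ts zs"
      using full_TTr1_exists by blast
    note perp = opspan_perp_orthogonal_complement[OF a, unfolded Let_def]
    note basis = full_TTr1_basis[OF a, unfolded Let_def]
    show ?case
      unfolding Let_def
    proof (intro conjI, goal_cases)
      case 1 show ?case by (rule perp[THEN conjunct1])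
    next
      case 2 show ?case by (rule perp[THEN conjunct2, THEN conjunct1])
    next
      case 3 show ?case by (rule perp[THEN conjunct2, THEN conjunct2, THEN conjunct1])
    next
      case 4 show ?case by (rule perp[THEN conjunct2, THEN conjunct2, THEN conjunct2, THEN conjunct1])
    next
      case 5 show ?case by (rule perp[THEN conjunct2, THEN conjunct2, THEN conjunct2, THEN conjunct2])
    next
      case 6 show ?case by (intro impI conjI[OF ex] allI basis)
    qed
  qed
next
  case 2
  have N: "prod_list [3, 4, 2 :: nat] = 24" by simp
  show ?case
    unfolding Let_def
  proof (rule conjI[OF example_svds_exist], intro allI impI, goal_cases)
    case (1 U S V UU SS VV)
    define ts where "ts = [(S $$ (i, i) * SS i $$ (j, j), [col U i, col (UU i) j, col (VV i) j]).
      i \<leftarrow> [0..<3], j \<leftarrow> [0..<2]]"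
    define zs where "zs = [[col U i, col (UU i) j, col (VV i) k].
      i \<leftarrow> [0..<3], j \<leftarrow> [0..<4], k \<leftarrow> [0..<2], j \<noteq> k]"
    have TT: "full_TTr1 [3, 4, 2] (vectorize [3, 4, 2] example_tensor) ts zs"
      unfolding ts_def zs_def using 1 by (intro example_full_TTr1) blast+
    have len: "length ts = 6" "length zs = 18" by (simp_all add: ts_def zs_def upt_small)
    have P: "P \<in> carrier_mat 6 5" if "perp_matrix (vec_of_list (map fst ts)) P" for P
      using that len by (simp add: perp_matrix_def)
    note basis = full_TTr1_basis[OF example_tensor_nonzero TT, unfolded Let_def N length_map len,
        THEN conjunct2, THEN conjunct2]
    show ?case
      unfolding ts_def[symmetric] zs_def[symmetric]
    proof (intro conjI, goal_cases)
      case 1 show ?case by (rule TT)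
    next
      case 2 show ?case by (simp add: len)
    next
      case 3 show ?case by (simp add: len)
    next
      case 4 show ?case by (rule basis[THEN conjunct1])
    next
      case 5 show ?case by (rule basis[THEN conjunct2, THEN conjunct1])
    next
      case 6 show ?case by (rule basis[THEN conjunct2, THEN conjunct2, THEN conjunct1])
    next
      case 7 show ?case
        by (rule basis[THEN conjunct2, THEN conjunct2, THEN conjunct2, THEN conjunct1])
    next
      case 8
      note perp = basis[THEN conjunct2, THEN conjunct2, THEN conjunct2, THEN conjunct2]
      show ?case by (intro allI impI conjI[OF P perp[THEN spec, THEN mp]])
    qed
  qed
qed

end
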